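(* Let $a>b>0$, $c^2=a^2-b^2$, let $\mathcal{E}$ be the ellipse $x^2/a^2+y^2/b^2=1$, and let $C=[x_c,y_c]$ be a point interior to $\mathcal{E}$. Let $\mathcal{T}_\circ$ be the Poncelet family of triangles inscribed in $\mathcal{E}$ and circumscribing a circle centered at $C$. Then the locus $\mathcal{L}_8$ of Nagel's point $X_8$ over $\mathcal{T}_\circ$ is an ellipse homothetic to and concentric with $\mathcal{E}$. Its semi-axis lengths $a_8,b_8$ (along the $x$- and $y$-directions) are \[ a_8=\frac{\sqrt{\delta_8}}{bc^2},\qquad b_8=\frac{\sqrt{\delta_8}}{ac^2},\qquad \delta_8=(a^3b+ab^3-2\delta)^2+4c^4x_c^2y_c^2, \] where $\delta=\sqrt{(b^4+c^2y_c^2)(a^4-c^2x_c^2)}$.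
   Context: For each point $C=[x_c,y_c]$ interior to $\mathcal{E}$ there is exactly one circle $\mathcal{K}$ centered at $C$, nested in $\mathcal{E}$, admitting triangles inscribed in $\mathcal{E}$ with all sides tangent to $\mathcal{K}$; its radius is $r=\big(b\sqrt{a^4-c^2x_c^2}-a\sqrt{b^4+c^2y_c^2}\big)/c^2$. By Poncelet's porism every point of $\mathcal{E}$ is then a vertex of exactly one such triangle. $\mathcal{T}_\circ$ is the family of all these triangles; $\mathcal{K}$ is their common incircle. The locus $\mathcal{L}_k$ of a triangle center $X_k$ is the set of positions of $X_k(T)$ as $T$ ranges over $\mathcal{T}_\circ$. Nagel's point $X_8$ is the point of concurrence of the lines from each vertex to the point where the opposite side touches the corresponding excircle; with sidelengths $l_1,l_2,l_3$ its barycentrics are $l_2+l_3-l_1:l_3+l_1-l_2:l_1+l_2-l_3$. Convention: an ellipse with both semi-axes zero means a single point (degenerate case). *)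

theory Defs
  imports "HOL-Analysis.Analysis"
begin

type_synonym point = "real \<times> real"

text \<open>
  The ellipse with centre \<open>z\<close> and semi-axes \<open>p\<close>, \<open>q\<close> along the coordinate directions.
  By convention an ellipse with both semi-axes zero is a single point.
\<close>
definition ellipse :: "point \<Rightarrow> real \<Rightarrow> real \<Rightarrow> point set" where
  "ellipse z p q =
     (if p = 0 \<and> q = 0 then {z}
      else {(x, y). (x - fst z)\<^sup>2 / p\<^sup>2 + (y - snd z)\<^sup>2 / q\<^sup>2 = 1})"

definition ellipse_interior :: "point \<Rightarrow> real \<Rightarrow> real \<Rightarrow> point set" where
  "ellipse_interior z p q = {(x, y). (x - fst z)\<^sup>2 / p\<^sup>2 + (y - snd z)\<^sup>2 / q\<^sup>2 < 1}"

text \<open>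
  For distinct \<open>A\<close>, \<open>B\<close> and \<open>r > 0\<close>: the line \<open>AB\<close> is tangent at \<open>T\<close> to the circle
  with centre \<open>J\<close> and radius \<open>r\<close>, since they have no other common point.
\<close>
definition tangent_at :: "point \<Rightarrow> point \<Rightarrow> point \<Rightarrow> real \<Rightarrow> point \<Rightarrow> bool" where
  "tangent_at A B J r T \<longleftrightarrow> affine hull {A, B} \<inter> sphere J r = {T}"

definition circumscribes :: "point \<Rightarrow> point \<Rightarrow> point \<Rightarrow> point \<Rightarrow> real \<Rightarrow> bool" where
  "circumscribes P\<^sub>1 P\<^sub>2 P\<^sub>3 J r \<longleftrightarrow>
     (\<exists>T. tangent_at P\<^sub>1 P\<^sub>2 J r T) \<and> (\<exists>T. tangent_at P\<^sub>2 P\<^sub>3 J r T) \<and> (\<exists>T. tangent_at P\<^sub>3 P\<^sub>1 J r T)"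

text \<open>
  Triangles are given by their (ordered) vertices. The circle is required to be nested in the
  ellipse, hence it touches each side line inside the side and is the incircle. Only one
  radius \<open>r\<close> admits such triangles, so the quantifier over \<open>r\<close> does not join different families.
\<close>
definition poncelet_family :: "real \<Rightarrow> real \<Rightarrow> point \<Rightarrow> (point \<times> point \<times> point) set" where
  "poncelet_family a b C =
     {(P\<^sub>1, P\<^sub>2, P\<^sub>3).
        \<not> collinear {P\<^sub>1, P\<^sub>2, P\<^sub>3} \<and> {P\<^sub>1, P\<^sub>2, P\<^sub>3} \<subseteq> ellipse (0, 0) a b \<and>
        (\<exists>r>0. sphere C r \<subseteq> ellipse_interior (0, 0) a b \<and> circumscribes P\<^sub>1 P\<^sub>2 P\<^sub>3 C r)}"

text \<open>
  \<open>T\<close> is the point where the excircle opposite \<open>A\<close> touches the side \<open>BC\<close>. Among the circles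
  tangent to the three side lines, that excircle is the one touching \<open>BC\<close> between \<open>B\<close> and \<open>C\<close>,
  and the other two side lines beyond \<open>B\<close> and \<open>C\<close>.
\<close>
definition excircle_touch :: "point \<Rightarrow> point \<Rightarrow> point \<Rightarrow> point \<Rightarrow> bool" where
  "excircle_touch A B C T \<longleftrightarrow>
     (\<exists>J r X Y. r > 0 \<and>
        tangent_at B C J r T \<and> T \<in> open_segment B C \<and>
        tangent_at A B J r X \<and> B \<in> open_segment A X \<and>
        tangent_at A C J r Y \<and> C \<in> open_segment A Y)"

definition nagel_point :: "point \<Rightarrow> point \<Rightarrow> point \<Rightarrow> point \<Rightarrow> bool" where
  "nagel_point P\<^sub>1 P\<^sub>2 P\<^sub>3 N \<longleftrightarrow>
     (\<exists>T\<^sub>1 T\<^sub>2 T\<^sub>3.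
        excircle_touch P\<^sub>1 P\<^sub>2 P\<^sub>3 T\<^sub>1 \<and> excircle_touch P\<^sub>2 P\<^sub>3 P\<^sub>1 T\<^sub>2 \<and> excircle_touch P\<^sub>3 P\<^sub>1 P\<^sub>2 T\<^sub>3 \<and>
        N \<in> affine hull {P\<^sub>1, T\<^sub>1} \<and> N \<in> affine hull {P\<^sub>2, T\<^sub>2} \<and> N \<in> affine hull {P\<^sub>3, T\<^sub>3})"

text \<open>
  A triangle centre is given as a relation between the three vertices and the centre.
\<close>
definition locus ::
  "(point \<times> point \<times> point) set \<Rightarrow> (point \<Rightarrow> point \<Rightarrow> point \<Rightarrow> point \<Rightarrow> bool) \<Rightarrow> point set" where
  "locus F X = {N. \<exists>(P\<^sub>1, P\<^sub>2, P\<^sub>3) \<in> F. X P\<^sub>1 P\<^sub>2 P\<^sub>3 N}"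

end

theory Submission
  imports Defs "HOL-Computational_Algebra.Fundamental_Theorem_Algebra"
begin

text \<open>
  If the circle with centre \<open>C\<close> is the incircle of \<open>P\<^sub>1 P\<^sub>2 P\<^sub>3\<close>, then Nagel's point is
  \<open>P\<^sub>1 + P\<^sub>2 + P\<^sub>3 - 2 C\<close>. The affine map sending the outer ellipse to the unit circle turns the vertices
  into unimodular \<open>z\<^sub>1, z\<^sub>2, z\<^sub>3\<close> and the circle into an ellipse with centre \<open>m\<close> and foci \<open>f, g\<close>. Tangency
  of the sides says that all three vertices solve \<open>z (z - f) (z - g) = l (1 - cnj f z) (1 - cnj g z)\<close>
  with \<open>l = z\<^sub>1 z\<^sub>2 z\<^sub>3\<close>, hence \<open>z\<^sub>1 + z\<^sub>2 + z\<^sub>3 = 2 m + l cnj (f g)\<close> because \<open>f + g = 2 m\<close>. So Nagel's point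
  is the image of \<open>l cnj (f g)\<close>, with \<open>l\<close> on the unit circle. Conversely, for every unimodular \<open>l\<close> the
  roots of this cubic are unimodular and distinct, and their images form a triangle of the family.
\<close>

section \<open>Tangent lines and Nagel's point\<close>

definition cross :: "point \<Rightarrow> point \<Rightarrow> real" where
  "cross u v = fst u * snd v - snd u * fst v"

text \<open>Lagrange's identity in the plane. It links perpendicularity to distances and equality in
  Cauchy-Schwarz to a vanishing \<open>cross\<close>.\<close>

lemma cross_inner: "(cross u v)\<^sup>2 + (u \<bullet> v)\<^sup>2 = (norm u)\<^sup>2 * (norm v)\<^sup>2"
  unfolding cross_def power2_norm_eq_inner inner_prod_def by (simp add: algebra_simps power2_eq_square)

lemma orthogonal_to_basis_zero:
  assumes "cross u v \<noteq> 0" and "w \<bullet> u = 0" and "w \<bullet> v = 0"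
  shows "w = 0"
proof -
  have "fst w * cross u v = 0" "snd w * cross u v = 0"
    using assms(2,3) unfolding cross_def inner_prod_def inner_real_def by algebra+
  then show ?thesis
    using assms(1) by (simp add: prod_eq_iff)
qed

lemma collinear_iff_cross: "collinear {A, B, C} \<longleftrightarrow> cross (B - A) (C - A) = 0"
proof -
  have "collinear {A, B, C} \<longleftrightarrow> collinear {0, B - A, C - A}"
    using collinear_3[of B A C] by (simp add: insert_commute)
  also have "\<dots> \<longleftrightarrow> \<bar>(B - A) \<bullet> (C - A)\<bar> = norm (B - A) * norm (C - A)"
    by (simp add: norm_cauchy_schwarz_equal)
  also have "\<dots> \<longleftrightarrow> \<bar>(B - A) \<bullet> (C - A)\<bar>\<^sup>2 = (norm (B - A) * norm (C - A))\<^sup>2"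
    by (metis abs_ge_zero mult_nonneg_nonneg norm_ge_zero power2_eq_iff_nonneg)
  also have "\<dots> \<longleftrightarrow> cross (B - A) (C - A) = 0"
    using cross_inner[of "B - A" "C - A"] by (auto simp: power_mult_distrib)
  finally show ?thesis .
qed

lemma mem_line_iff: "X \<in> affine hull {A, B} \<longleftrightarrow> (\<exists>t. X = A + t *\<^sub>R (B - A))"
  for A B :: "'a::real_vector"
proof -
  have "X \<in> affine hull {A, B} \<longleftrightarrow> (\<exists>u v. X = u *\<^sub>R A + v *\<^sub>R B \<and> u + v = 1)"
    unfolding affine_hull_2 by auto
  also have "\<dots> \<longleftrightarrow> (\<exists>t. X = A + t *\<^sub>R (B - A))"
  proof
    assume "\<exists>u v. X = u *\<^sub>R A + v *\<^sub>R B \<and> u + v = 1"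
    then obtain u v where uv: "X = u *\<^sub>R A + v *\<^sub>R B" "u = 1 - v" by (metis eq_diff_eq)
    then have "X = A + v *\<^sub>R (B - A)" by (simp add: algebra_simps)
    then show "\<exists>t. X = A + t *\<^sub>R (B - A)" ..
  next
    assume "\<exists>t. X = A + t *\<^sub>R (B - A)"
    then obtain t where "X = A + t *\<^sub>R (B - A)" ..
    then have "X = (1 - t) *\<^sub>R A + t *\<^sub>R B" by (simp add: algebra_simps)
    then show "\<exists>u v. X = u *\<^sub>R A + v *\<^sub>R B \<and> u + v = 1" by force
  qed
  finally show ?thesis .
qed

section \<open>Tangency by perpendiculars, and tangent lengths\<close>

lemma norm_add_sq: "(norm (x + y))\<^sup>2 = (norm x)\<^sup>2 + 2 * (x \<bullet> y) + (norm y)\<^sup>2"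
  for x y :: "'a::real_inner"
  by (simp add: power2_norm_eq_inner inner_add inner_commute)

text \<open>The common points of a line and a circle are symmetric about the foot of the
  perpendicular from the centre, so a single common point is that foot. The converse is
  Pythagoras.\<close>

lemma tangent_at_iff:
  assumes "A \<noteq> B"
  shows "tangent_at A B J r T \<longleftrightarrow>
    T \<in> affine hull {A, B} \<and> (T - J) \<bullet> (B - A) = 0 \<and> dist J T = r"
proof
  assume tan: "tangent_at A B J r T"
  then have T: "T \<in> affine hull {A, B}" "dist J T = r"
    unfolding tangent_at_def by auto
  from T(1) obtain t where t: "T = A + t *\<^sub>R (B - A)" unfolding mem_line_iff ..
  define e where "e = B - A"
  have e: "e \<bullet> e > 0" using assms by (simp add: e_def)
  \<comment> \<open>This \<open>k\<close> makes \<open>T'\<close> the mirror image of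
    \<open>T\<close> in the foot of the perpendicular from \<open>J\<close>; it lies on the line and
    the circle again, so uniqueness forces \<open>k = 0\<close>.\<close>
  define k where "k = - 2 * ((T - J) \<bullet> e) / (e \<bullet> e)"
  define T' where "T' = T + k *\<^sub>R e"
  have "T' = A + (t + k) *\<^sub>R (B - A)"
    unfolding T'_def t e_def by (simp add: algebra_simps)
  then have line: "T' \<in> affine hull {A, B}" unfolding mem_line_iff by blast
  have "(norm (T' - J))\<^sup>2 = (norm ((T - J) + k *\<^sub>R e))\<^sup>2"
    unfolding T'_def by (simp add: algebra_simps)
  also have "\<dots> = (norm (T - J))\<^sup>2 + k * (2 * ((T - J) \<bullet> e) + k * (e \<bullet> e))"
    unfolding norm_add_sq power2_norm_eq_inner[of "k *\<^sub>R e"] inner_scaleR_left inner_scaleR_right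
    by algebra
  also have "2 * ((T - J) \<bullet> e) + k * (e \<bullet> e) = 0"
    using e by (simp add: k_def)
  finally have "norm (T' - J) = norm (T - J)" by simp
  then have "dist J T' = r" using T(2) by (simp add: dist_norm norm_minus_commute)
  then have "T' \<in> affine hull {A, B} \<inter> sphere J r" using line by simp
  then have "T' = T" using tan unfolding tangent_at_def by blast
  then have "k = 0" using assms by (simp add: T'_def e_def)
  then have "(T - J) \<bullet> e = 0" using e by (simp add: k_def)
  with T show "T \<in> affine hull {A, B} \<and> (T - J) \<bullet> (B - A) = 0 \<and> dist J T = r"
    by (simp add: e_def)
next
  assume *: "T \<in> affine hull {A, B} \<and> (T - J) \<bullet> (B - A) = 0 \<and> dist J T = r"
  then obtain t where t: "T = A + t *\<^sub>R (B - A)" unfolding mem_line_iff by blast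
  have "X = T" if X: "X \<in> affine hull {A, B}" "dist J X = r" for X
  proof -
    from X(1) obtain s where s: "X = A + s *\<^sub>R (B - A)" unfolding mem_line_iff ..
    define k where "k = s - t"
    have XT: "X = T + k *\<^sub>R (B - A)" unfolding s t k_def by (simp add: algebra_simps)
    have "(norm (X - J))\<^sup>2 = (norm ((T - J) + k *\<^sub>R (B - A)))\<^sup>2"
      unfolding XT by (simp add: algebra_simps)
    also have "\<dots> = (norm (T - J))\<^sup>2 + (norm (k *\<^sub>R (B - A)))\<^sup>2"
      unfolding norm_add_sq using * by simp
    finally have "norm (k *\<^sub>R (B - A)) = 0"
      using * X(2) by (simp add: dist_norm norm_minus_commute)
    then show ?thesis by (simp add: XT)
  qed
  then have "X = T" if "X \<in> affine hull {A, B} \<inter> sphere J r" for X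
    using that by simp
  moreover have "T \<in> affine hull {A, B} \<inter> sphere J r" using * by simp
  ultimately show "tangent_at A B J r T" unfolding tangent_at_def by blast
qed

text \<open>Up to sign, \<open>cross (A - J) (B - J)\<close> is the distance of \<open>J\<close>
  from the line times the length of \<open>AB\<close>. Squaring removes the sign and the
  root.\<close>

lemma ex_tangent_at_iff:
  assumes "A \<noteq> B" and "r > 0"
  shows "(\<exists>T. tangent_at A B J r T) \<longleftrightarrow> (cross (A - J) (B - J))\<^sup>2 = r\<^sup>2 * (norm (B - A))\<^sup>2"
proof -
  have shift: "cross (A - J) (B - J) = cross (A + t *\<^sub>R (B - A) - J) (B - A)" for t
    unfolding cross_def by (simp add: algebra_simps)
  have e: "(norm (B - A))\<^sup>2 > 0" using assms by simp
  show ?thesis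
  proof
    assume "\<exists>T. tangent_at A B J r T"
    then obtain T where T: "T \<in> affine hull {A, B}" "(T - J) \<bullet> (B - A) = 0" "dist J T = r"
      using tangent_at_iff[OF assms(1)] by blast
    from T(1) obtain t where t: "T = A + t *\<^sub>R (B - A)" unfolding mem_line_iff ..
    show "(cross (A - J) (B - J))\<^sup>2 = r\<^sup>2 * (norm (B - A))\<^sup>2"
      using cross_inner[of "T - J" "B - A"] T shift[of t]
      by (simp add: t dist_norm norm_minus_commute)
  next
    assume *: "(cross (A - J) (B - J))\<^sup>2 = r\<^sup>2 * (norm (B - A))\<^sup>2"
    \<comment> \<open>The parameter of the foot of the perpendicular from \<open>J\<close>.\<close>
    define t where "t = - ((A - J) \<bullet> (B - A)) / (norm (B - A))\<^sup>2"
    define T where "T = A + t *\<^sub>R (B - A)"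
    have "(T - J) \<bullet> (B - A) = (A - J) \<bullet> (B - A) + t * (norm (B - A))\<^sup>2"
      unfolding T_def power2_norm_eq_inner by (simp add: algebra_simps)
    also have "\<dots> = 0" using e by (simp add: t_def)
    finally have orth: "(T - J) \<bullet> (B - A) = 0" .
    have "r\<^sup>2 * (norm (B - A))\<^sup>2 = (norm (T - J))\<^sup>2 * (norm (B - A))\<^sup>2"
      using cross_inner[of "T - J" "B - A"] * shift[of t] orth by (simp add: T_def)
    then have "dist J T = r" using e assms(2) by (simp add: dist_norm norm_minus_commute)
    moreover have "T \<in> affine hull {A, B}" unfolding mem_line_iff T_def by blast
    ultimately show "\<exists>T. tangent_at A B J r T"
      using tangent_at_iff[OF assms(1)] orth by blast
  qed
qed

text \<open>Pythagoras in the triangle \<open>A\<close>, \<open>T\<close>, \<open>J\<close> with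
  right angle at \<open>T\<close>.\<close>

lemma tangent_length:
  assumes "A \<noteq> B" and "tangent_at A B J r T"
  shows "(dist A T)\<^sup>2 = (dist A J)\<^sup>2 - r\<^sup>2"
proof -
  from assms have T: "T \<in> affine hull {A, B}" "(T - J) \<bullet> (B - A) = 0" "dist J T = r"
    using tangent_at_iff by blast+
  from T(1) obtain t where t: "T = A + t *\<^sub>R (B - A)" unfolding mem_line_iff ..
  have "(norm (A - J))\<^sup>2 = (norm ((T - J) + (- t) *\<^sub>R (B - A)))\<^sup>2"
    by (simp add: t algebra_simps)
  also have "\<dots> = r\<^sup>2 + (norm (A - T))\<^sup>2"
    unfolding norm_add_sq using T by (simp add: t dist_norm norm_minus_commute)
  finally show ?thesis by (simp add: dist_norm)
qed

lemma tangent_lengths_eq: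
  assumes "A \<noteq> B" "A \<noteq> C" "tangent_at A B J r X" "tangent_at A C J r Y"
  shows "dist A X = dist A Y"
proof -
  have "(dist A X)\<^sup>2 = (dist A Y)\<^sup>2"
    using tangent_length[OF assms(1,3)] tangent_length[OF assms(2,4)] by simp
  then show ?thesis by simp
qed

lemma tangent_at_commute: "tangent_at A B J r T \<longleftrightarrow> tangent_at B A J r T"
  unfolding tangent_at_def by (simp add: insert_commute)

lemma dist_open_segment:
  fixes A B T :: "'a::euclidean_space"
  assumes "T \<in> open_segment A B"
  shows "dist A B = dist A T + dist T B"
    and "T = A + (dist A T / dist A B) *\<^sub>R (B - A)" and "A \<noteq> B" and "T \<noteq> A" and "T \<noteq> B"
proof -
  from assms obtain u where u: "0 < u" "u < 1" "T = (1 - u) *\<^sub>R A + u *\<^sub>R B" and AB: "A \<noteq> B"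
    unfolding in_segment by blast
  have T: "T = A + u *\<^sub>R (B - A)" using u(3) by (simp add: algebra_simps)
  have "A - T = u *\<^sub>R (A - B)" "T - B = (1 - u) *\<^sub>R (A - B)"
    unfolding T by (simp_all add: algebra_simps)
  then have d: "dist A T = u * dist A B" "dist T B = (1 - u) * dist A B"
    using u by (simp_all add: dist_norm)
  show "dist A B = dist A T + dist T B" unfolding d by (simp add: algebra_simps)
  show "A \<noteq> B" by (fact AB)
  show "T = A + (dist A T / dist A B) *\<^sub>R (B - A)"
    unfolding d(1) using T AB by simp
  show "T \<noteq> A" "T \<noteq> B" using assms unfolding open_segment_def by auto
qed

section \<open>Excircles, Nagel's point and the incentre in terms of tangent lengths\<close>

lemma norm_sq_comb:
  "(norm (\<alpha> *\<^sub>R u + \<beta> *\<^sub>R v))\<^sup>2 = \<alpha>\<^sup>2 * (u \<bullet> u) + 2 * \<alpha> * \<beta> * (u \<bullet> v) + \<beta>\<^sup>2 * (v \<bullet> v)"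
  for u v :: "'a::real_inner"
  unfolding power2_norm_eq_inner
  by (simp add: inner_add inner_commute[of v u] power2_eq_square algebra_simps)

text \<open>The excentre is the image of the incentre under the homothety with centre \<open>A\<close> and
  ratio \<open>(s\<^sub>1 + s\<^sub>2 + s\<^sub>3) / s\<^sub>1\<close>, where \<open>s\<^sub>1, s\<^sub>2, s\<^sub>3\<close> are the tangent lengths of the incircle.\<close>
lemma excircle_touch_iff:
  assumes s: "s\<^sub>1 > 0" "s\<^sub>2 > 0" "s\<^sub>3 > 0"
    and d: "dist A B = s\<^sub>1 + s\<^sub>2" "dist B C = s\<^sub>2 + s\<^sub>3" "dist C A = s\<^sub>3 + s\<^sub>1"
  shows "excircle_touch A B C T \<longleftrightarrow> T = B + (s\<^sub>3 / (s\<^sub>2 + s\<^sub>3)) *\<^sub>R (C - B)"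
proof
  assume "excircle_touch A B C T"
  then obtain J r X Y where
    T: "tangent_at B C J r T" "T \<in> open_segment B C" and
    X: "tangent_at A B J r X" "B \<in> open_segment A X" and
    Y: "tangent_at A C J r Y" "C \<in> open_segment A Y"
    unfolding excircle_touch_def by blast
  have ne: "A \<noteq> B" "B \<noteq> C" "A \<noteq> C" using s d by auto
  have "dist A X = dist A Y" using tangent_lengths_eq ne X(1) Y(1) by blast
  moreover have "dist B X = dist B T" using tangent_lengths_eq ne X(1) T(1) tangent_at_commute by metis
  moreover have "dist C Y = dist C T" using tangent_lengths_eq ne Y(1) T(1) tangent_at_commute by metis
  moreover note dist_open_segment(1)[OF T(2)] dist_open_segment(1)[OF X(2)] dist_open_segment(1)[OF Y(2)]
  \<comment> \<open>Equal tangents from \<open>A\<close> give \<open>AB + BT = AC + CT\<close>;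
    together with \<open>BT + TC = BC\<close> this determines \<open>BT\<close>.\<close>
  ultimately have "dist B T = s\<^sub>3" using d by (simp add: dist_commute)
  then show "T = B + (s\<^sub>3 / (s\<^sub>2 + s\<^sub>3)) *\<^sub>R (C - B)"
    using dist_open_segment(2)[OF T(2)] d(2) by simp
next
  assume T: "T = B + (s\<^sub>3 / (s\<^sub>2 + s\<^sub>3)) *\<^sub>R (C - B)"
  define u v where "u = B - A" and "v = C - A"
  have B: "B = A + u" and C: "C = A + v" by (simp_all add: u_def v_def)
  have ne: "A \<noteq> B" "B \<noteq> C" "A \<noteq> C" using s d by auto
  \<comment> \<open>The law of cosines expresses all inner products of \<open>u\<close> and
    \<open>v\<close> by tangent lengths; the tangency checks below become rational algebra.\<close>
  have uu: "u \<bullet> u = (s\<^sub>1 + s\<^sub>2)\<^sup>2"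
    using d(1) by (simp add: dist_norm u_def norm_minus_commute flip: power2_norm_eq_inner)
  have vv: "v \<bullet> v = (s\<^sub>3 + s\<^sub>1)\<^sup>2"
    using d(3) by (simp add: dist_norm v_def norm_minus_commute flip: power2_norm_eq_inner)
  have "(u - v) \<bullet> (u - v) = (s\<^sub>2 + s\<^sub>3)\<^sup>2"
    using d(2) by (simp add: dist_norm u_def v_def flip: power2_norm_eq_inner)
  then have uv: "u \<bullet> v = s\<^sub>1\<^sup>2 + s\<^sub>1 * s\<^sub>2 + s\<^sub>1 * s\<^sub>3 - s\<^sub>2 * s\<^sub>3"
    using uu vv by (simp add: inner_diff inner_commute algebra_simps power2_eq_square)
  define p where "p = s\<^sub>1 + s\<^sub>2 + s\<^sub>3"
  define J where "J = A + ((s\<^sub>1 + s\<^sub>3) / (2 * s\<^sub>1)) *\<^sub>R u + ((s\<^sub>1 + s\<^sub>2) / (2 * s\<^sub>1)) *\<^sub>R v"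
  \<comment> \<open>The tangents from \<open>A\<close> to the excircle have the semiperimeter
    \<open>p\<close> as length. Its radius is the area, by Heron's formula, divided by
    \<open>s\<^sub>1\<close>.\<close>
  define X where "X = A + (p / (s\<^sub>1 + s\<^sub>2)) *\<^sub>R u"
  define Y where "Y = A + (p / (s\<^sub>1 + s\<^sub>3)) *\<^sub>R v"
  define r where "r = sqrt (p * s\<^sub>2 * s\<^sub>3 / s\<^sub>1)"
  have p: "p > 0" using s by (simp add: p_def)
  have r: "r > 0" using s p by (simp add: r_def)
  have r2: "r\<^sup>2 = p * s\<^sub>2 * s\<^sub>3 / s\<^sub>1" using s p by (simp add: r_def)
  have nz: "s\<^sub>1 \<noteq> 0" "s\<^sub>2 + s\<^sub>3 \<noteq> 0" "s\<^sub>1 + s\<^sub>2 \<noteq> 0" "s\<^sub>1 + s\<^sub>3 \<noteq> 0" using s by auto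
  have eq: "dist J Z = r" if "(norm (Z - J))\<^sup>2 = p * s\<^sub>2 * s\<^sub>3 / s\<^sub>1" for Z
    using that r by (simp add: dist_norm norm_minus_commute flip: r2)
  have T': "T = A + (1 - s\<^sub>3 / (s\<^sub>2 + s\<^sub>3)) *\<^sub>R u + (s\<^sub>3 / (s\<^sub>2 + s\<^sub>3)) *\<^sub>R v"
    unfolding T B C by (simp add: algebra_simps)
  have TJ: "T - J = (1 - s\<^sub>3 / (s\<^sub>2 + s\<^sub>3) - (s\<^sub>1 + s\<^sub>3) / (2 * s\<^sub>1)) *\<^sub>R u
      + (s\<^sub>3 / (s\<^sub>2 + s\<^sub>3) - (s\<^sub>1 + s\<^sub>2) / (2 * s\<^sub>1)) *\<^sub>R v"
    unfolding T' J_def by (simp add: algebra_simps)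
  have XJ: "X - J = (p / (s\<^sub>1 + s\<^sub>2) - (s\<^sub>1 + s\<^sub>3) / (2 * s\<^sub>1)) *\<^sub>R u + (- ((s\<^sub>1 + s\<^sub>2) / (2 * s\<^sub>1))) *\<^sub>R v"
    unfolding X_def J_def by (simp add: algebra_simps)
  have YJ: "Y - J = (- ((s\<^sub>1 + s\<^sub>3) / (2 * s\<^sub>1))) *\<^sub>R u + (p / (s\<^sub>1 + s\<^sub>3) - (s\<^sub>1 + s\<^sub>2) / (2 * s\<^sub>1)) *\<^sub>R v"
    unfolding Y_def J_def by (simp add: algebra_simps)
  have CB: "C - B = v - u" by (simp add: B C)
  have tT: "tangent_at B C J r T"
    unfolding tangent_at_iff[OF ne(2)]
  proof (intro conjI eq)
    show "T \<in> affine hull {B, C}" unfolding mem_line_iff T by blast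
    show "(T - J) \<bullet> (C - B) = 0"
      unfolding TJ CB inner_add inner_diff inner_scaleR_left using nz
      by (simp add: uu vv uv inner_commute[of v u] divide_simps) algebra
    show "(norm (T - J))\<^sup>2 = p * s\<^sub>2 * s\<^sub>3 / s\<^sub>1"
      unfolding TJ norm_sq_comb uu vv uv p_def using nz
      by (simp add: divide_simps) algebra
  qed
  have tX: "tangent_at A B J r X"
    unfolding tangent_at_iff[OF ne(1)]
  proof (intro conjI eq)
    show "X \<in> affine hull {A, B}" unfolding mem_line_iff X_def u_def by blast
    show "(X - J) \<bullet> (B - A) = 0"
      unfolding XJ u_def[symmetric] inner_add inner_diff inner_scaleR_left p_def using nz
      by (simp add: uu vv uv inner_commute[of v u] divide_simps) algebra
    show "(norm (X - J))\<^sup>2 = p * s\<^sub>2 * s\<^sub>3 / s\<^sub>1"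
      unfolding XJ norm_sq_comb uu vv uv p_def using nz
      by (simp add: divide_simps) algebra
  qed
  have tY: "tangent_at A C J r Y"
    unfolding tangent_at_iff[OF ne(3)]
  proof (intro conjI eq)
    show "Y \<in> affine hull {A, C}" unfolding mem_line_iff Y_def v_def by blast
    show "(Y - J) \<bullet> (C - A) = 0"
      unfolding YJ v_def[symmetric] inner_add inner_diff inner_scaleR_left p_def using nz
      by (simp add: uu vv uv inner_commute[of v u] divide_simps) algebra
    show "(norm (Y - J))\<^sup>2 = p * s\<^sub>2 * s\<^sub>3 / s\<^sub>1"
      unfolding YJ norm_sq_comb uu vv uv p_def using nz
      by (simp add: divide_simps) algebra
  qed
  have seg: "P + t *\<^sub>R (R - P) \<in> open_segment P R" if "P \<noteq> R" "0 < t" "t < 1" for P R :: point and t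
    unfolding in_segment using that by (auto intro!: exI[of _ t] simp: algebra_simps)
  have "T \<in> open_segment B C" unfolding T using seg ne s by simp
  moreover have "B \<in> open_segment A X"
  proof -
    have "X \<noteq> A" using ne p nz by (simp add: X_def u_def)
    moreover have "B = A + ((s\<^sub>1 + s\<^sub>2) / p) *\<^sub>R (X - A)" using nz p by (simp add: X_def u_def)
    ultimately show ?thesis using seg[of A X "(s\<^sub>1 + s\<^sub>2) / p"] s p by (simp add: p_def)
  qed
  moreover have "C \<in> open_segment A Y"
  proof -
    have "Y \<noteq> A" using ne p nz by (simp add: Y_def v_def)
    moreover have "C = A + ((s\<^sub>1 + s\<^sub>3) / p) *\<^sub>R (Y - A)" using nz p by (simp add: Y_def v_def)
    ultimately show ?thesis using seg[of A Y "(s\<^sub>1 + s\<^sub>3) / p"] s p by (simp add: p_def)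
  qed
  ultimately show "excircle_touch A B C T"
    unfolding excircle_touch_def using r tT tX tY by blast
qed

lemma line_through_ratio:
  assumes "X = A + k *\<^sub>R (B - A)" and "k \<noteq> 0"
  shows "affine hull {A, X} = affine hull {A, B}"
proof -
  have "\<exists>t. Y = A + t *\<^sub>R (B - A)" if "Y = A + t *\<^sub>R (X - A)" for Y t
    using that assms(1) by (intro exI[of _ "t * k"]) simp
  moreover have "\<exists>t. Y = A + t *\<^sub>R (X - A)" if "Y = A + t *\<^sub>R (B - A)" for Y t
    using that assms by (intro exI[of _ "t / k"]) simp
  ultimately show ?thesis unfolding set_eq_iff mem_line_iff by blast
qed

lemma lines_meet_once:
  assumes "cross (P - N) (Q - N) \<noteq> 0" and "X \<in> affine hull {P, N}" and "X \<in> affine hull {Q, N}"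
  shows "X = N"
proof -
  obtain s where s: "X = N + s *\<^sub>R (P - N)"
    using assms(2) mem_line_iff[of X N P] by (auto simp: insert_commute)
  obtain t where t: "X = N + t *\<^sub>R (Q - N)"
    using assms(3) mem_line_iff[of X N Q] by (auto simp: insert_commute)
  have eq: "s *\<^sub>R (P - N) = t *\<^sub>R (Q - N)" using s t by simp
  have "s * cross (P - N) (Q - N) = cross (s *\<^sub>R (P - N)) (Q - N)"
    unfolding cross_def by (simp add: algebra_simps)
  also have "\<dots> = 0" unfolding eq cross_def by simp
  finally have "s = 0" using assms(1) by simp
  then show ?thesis using s by simp
qed

text \<open>A tangent length is half of the two adjacent sides minus the opposite one, so the
  weights are the classical barycentrics. Each touching point divides its side in the ratio of two
  weights, which puts the weighted mean on all three cevians.\<close>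

lemma nagel_point_iff:
  assumes s: "s\<^sub>1 > 0" "s\<^sub>2 > 0" "s\<^sub>3 > 0"
    and d: "dist A B = s\<^sub>1 + s\<^sub>2" "dist B C = s\<^sub>2 + s\<^sub>3" "dist C A = s\<^sub>3 + s\<^sub>1"
    and nc: "\<not> collinear {A, B, C}"
  shows "nagel_point A B C N \<longleftrightarrow> N = (1 / (s\<^sub>1 + s\<^sub>2 + s\<^sub>3)) *\<^sub>R (s\<^sub>1 *\<^sub>R A + s\<^sub>2 *\<^sub>R B + s\<^sub>3 *\<^sub>R C)"
proof -
  define p where "p = s\<^sub>1 + s\<^sub>2 + s\<^sub>3"
  define N0 where "N0 = (1 / p) *\<^sub>R (s\<^sub>1 *\<^sub>R A + s\<^sub>2 *\<^sub>R B + s\<^sub>3 *\<^sub>R C)"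
  define D E F where "D = B + (s\<^sub>3 / (s\<^sub>2 + s\<^sub>3)) *\<^sub>R (C - B)"
    and "E = C + (s\<^sub>1 / (s\<^sub>3 + s\<^sub>1)) *\<^sub>R (A - C)" and "F = A + (s\<^sub>2 / (s\<^sub>1 + s\<^sub>2)) *\<^sub>R (B - A)"
  have p: "p > 0" using s by (simp add: p_def)
  have sums: "s\<^sub>2 + s\<^sub>3 \<noteq> 0" "s\<^sub>3 + s\<^sub>1 \<noteq> 0" "s\<^sub>1 + s\<^sub>2 \<noteq> 0" using s by auto
  have touch: "excircle_touch A B C T \<longleftrightarrow> T = D" "excircle_touch B C A T \<longleftrightarrow> T = E"
    "excircle_touch C A B T \<longleftrightarrow> T = F" for T
    unfolding D_def E_def F_def using excircle_touch_iff s d by blast+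
  have N0: "N0 = A + ((s\<^sub>2 + s\<^sub>3) / p) *\<^sub>R (D - A)" "N0 = B + ((s\<^sub>3 + s\<^sub>1) / p) *\<^sub>R (E - B)"
    "N0 = C + ((s\<^sub>1 + s\<^sub>2) / p) *\<^sub>R (F - C)"
    using p sums unfolding N0_def D_def E_def F_def prod_eq_iff
    by (simp_all add: divide_simps, simp_all add: p_def algebra_simps)
  have lines: "affine hull {A, D} = affine hull {A, N0}" "affine hull {B, E} = affine hull {B, N0}"
    "affine hull {C, F} = affine hull {C, N0}"
    using line_through_ratio N0 p sums by (metis divide_eq_0_iff less_irrefl)+
  \<comment> \<open>The triangle \<open>A\<close>, \<open>B\<close>, \<open>N0\<close> takes the
    share \<open>s\<^sub>3 / p\<close> of the area, the weight of \<open>C\<close>; hence two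
    cevians are not parallel.\<close>
  have "cross (A - N0) (B - N0) = s\<^sub>3 / p * cross (B - A) (C - A)"
    using p unfolding N0_def cross_def
    by (simp add: divide_simps) (simp add: p_def algebra_simps power2_eq_square)
  moreover have "cross (B - A) (C - A) \<noteq> 0" using nc collinear_iff_cross by blast
  ultimately have ne: "cross (A - N0) (B - N0) \<noteq> 0" using s p by simp
  have "nagel_point A B C N \<longleftrightarrow>
      N \<in> affine hull {A, N0} \<and> N \<in> affine hull {B, N0} \<and> N \<in> affine hull {C, N0}"
    unfolding nagel_point_def touch lines[symmetric] by blast
  also have "\<dots> \<longleftrightarrow> N = N0"
  proof -
    have "N0 \<in> affine hull {P, N0}" for P by (simp add: hull_inc)
    then show ?thesis using lines_meet_once[OF ne] by blast
  qed
  finally show ?thesis unfolding N0_def p_def .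
qed

text \<open>The incentre has weights side length over perimeter, that is
  \<open>(p - s\<^sub>i) / (2 * p)\<close>. Doubling it leaves the vertex sum minus the mean with
  weights \<open>s\<^sub>i / p\<close>. The projections \<open>orth\<close> determine
  \<open>J\<close>, so it is this point.\<close>

lemma incentre_eq:
  fixes A B C J :: point
  assumes s: "s\<^sub>1 > 0" "s\<^sub>2 > 0" "s\<^sub>3 > 0"
    and d: "dist A B = s\<^sub>1 + s\<^sub>2" "dist B C = s\<^sub>2 + s\<^sub>3" "dist C A = s\<^sub>3 + s\<^sub>1"
    and nc: "\<not> collinear {A, B, C}"
    and orth: "(J - A) \<bullet> (B - A) = s\<^sub>1 * (s\<^sub>1 + s\<^sub>2)" "(J - A) \<bullet> (C - A) = s\<^sub>1 * (s\<^sub>3 + s\<^sub>1)"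
  shows "2 *\<^sub>R J = A + B + C - (1 / (s\<^sub>1 + s\<^sub>2 + s\<^sub>3)) *\<^sub>R (s\<^sub>1 *\<^sub>R A + s\<^sub>2 *\<^sub>R B + s\<^sub>3 *\<^sub>R C)"
proof -
  define p where "p = s\<^sub>1 + s\<^sub>2 + s\<^sub>3"
  define u v where "u = B - A" and "v = C - A"
  have p: "p > 0" using s by (simp add: p_def)
  have uu: "u \<bullet> u = (s\<^sub>1 + s\<^sub>2)\<^sup>2"
    using d(1) by (simp add: dist_norm u_def norm_minus_commute flip: power2_norm_eq_inner)
  have vv: "v \<bullet> v = (s\<^sub>3 + s\<^sub>1)\<^sup>2"
    using d(3) by (simp add: dist_norm v_def norm_minus_commute flip: power2_norm_eq_inner)
  have "(u - v) \<bullet> (u - v) = (s\<^sub>2 + s\<^sub>3)\<^sup>2"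
    using d(2) by (simp add: dist_norm u_def v_def flip: power2_norm_eq_inner)
  then have uv: "u \<bullet> v = s\<^sub>1\<^sup>2 + s\<^sub>1 * s\<^sub>2 + s\<^sub>1 * s\<^sub>3 - s\<^sub>2 * s\<^sub>3"
    using uu vv by (simp add: inner_diff inner_commute algebra_simps power2_eq_square)
  define w where "w = ((s\<^sub>3 + s\<^sub>1) / (2 * p)) *\<^sub>R u + ((s\<^sub>1 + s\<^sub>2) / (2 * p)) *\<^sub>R v"
  have "w \<bullet> u = s\<^sub>1 * (s\<^sub>1 + s\<^sub>2)" "w \<bullet> v = s\<^sub>1 * (s\<^sub>3 + s\<^sub>1)"
    unfolding w_def inner_add inner_scaleR_left inner_commute[of v u] uu vv uv using p
    by (simp_all add: divide_simps) (simp_all add: p_def algebra_simps power2_eq_square)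
  then have "(J - A - w) \<bullet> u = 0" "(J - A - w) \<bullet> v = 0"
    using orth by (simp_all add: inner_diff_left u_def v_def)
  moreover have "cross u v \<noteq> 0" using nc collinear_iff_cross unfolding u_def v_def by blast
  ultimately have "J - A - w = 0" by (intro orthogonal_to_basis_zero)
  then have J: "J = A + w" by (simp add: algebra_simps)
  show ?thesis
    using p unfolding J w_def u_def v_def p_def[symmetric] prod_eq_iff
    by (simp add: divide_simps) (simp add: p_def algebra_simps)
qed

text \<open>Touching points between the vertices single out the incircle among the circles tangent
  to the side lines; then the tangent lengths add up to the sides.\<close>

lemma nagel_point_incentre:
  assumes nc: "\<not> collinear {A, B, C}"
    and X: "tangent_at A B J r X" "X \<in> open_segment A B"
    and Y: "tangent_at B C J r Y" "Y \<in> open_segment B C"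
    and Z: "tangent_at C A J r Z" "Z \<in> open_segment C A"
  shows "nagel_point A B C N \<longleftrightarrow> N = A + B + C - 2 *\<^sub>R J"
proof -
  have ne: "A \<noteq> B" "B \<noteq> C" "C \<noteq> A" using dist_open_segment(3) X Y Z by blast+
  define s\<^sub>1 s\<^sub>2 s\<^sub>3 where "s\<^sub>1 = dist A X" and "s\<^sub>2 = dist B Y" and "s\<^sub>3 = dist C Z"
  have s: "s\<^sub>1 > 0" "s\<^sub>2 > 0" "s\<^sub>3 > 0"
    using dist_open_segment(4) X(2) Y(2) Z(2) unfolding s\<^sub>1_def s\<^sub>2_def s\<^sub>3_def
    by (metis zero_less_dist_iff)+
  have eq: "dist A Z = s\<^sub>1" "dist B X = s\<^sub>2" "dist C Y = s\<^sub>3"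
    using tangent_lengths_eq tangent_at_commute ne X(1) Y(1) Z(1)
    unfolding s\<^sub>1_def s\<^sub>2_def s\<^sub>3_def by metis+
  have d: "dist A B = s\<^sub>1 + s\<^sub>2" "dist B C = s\<^sub>2 + s\<^sub>3" "dist C A = s\<^sub>3 + s\<^sub>1"
    using dist_open_segment(1)[OF X(2)] dist_open_segment(1)[OF Y(2)] dist_open_segment(1)[OF Z(2)] eq
    by (simp_all add: dist_commute s\<^sub>1_def s\<^sub>2_def s\<^sub>3_def)
  \<comment> \<open>\<open>T\<close> is the foot of the perpendicular from \<open>J\<close>, so
    projecting \<open>J - A\<close> onto the side gives the tangent length.\<close>
  have foot: "(J - A) \<bullet> (Q - A) = dist A T * dist A Q"
    if t: "tangent_at A Q J r T" "T \<in> open_segment A Q" for Q T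
  proof -
    have AQ: "A \<noteq> Q" using dist_open_segment(3) t(2) by blast
    have "(T - J) \<bullet> (Q - A) = 0" using tangent_at_iff AQ t(1) by blast
    then have "(J - A) \<bullet> (Q - A) = (T - A) \<bullet> (Q - A)" by (simp add: inner_diff_left)
    also have "T - A = (dist A T / dist A Q) *\<^sub>R (Q - A)"
      using dist_open_segment(2)[OF t(2)] by (metis add_diff_cancel_left')
    also have "\<dots> \<bullet> (Q - A) = dist A T / dist A Q * (dist A Q)\<^sup>2"
      by (simp add: power2_norm_eq_inner dist_norm norm_minus_commute[of A Q])
    also have "\<dots> = dist A T * dist A Q" using AQ by (simp add: power2_eq_square)
    finally show ?thesis .
  qed
  have orth: "(J - A) \<bullet> (B - A) = s\<^sub>1 * (s\<^sub>1 + s\<^sub>2)" "(J - A) \<bullet> (C - A) = s\<^sub>1 * (s\<^sub>3 + s\<^sub>1)"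
    using foot[OF X] foot[of C Z] Z eq(1) d
    by (simp_all add: tangent_at_commute open_segment_commute dist_commute s\<^sub>1_def)
  show ?thesis
    unfolding nagel_point_iff[OF s d nc] incentre_eq[OF s d nc orth] by simp
qed

section \<open>Reduction to the unit circle\<close>

text \<open>Real-linear, carrying the unit circle onto the outer ellipse. Complex coordinates turn
  conjugates of vertices into inverses.\<close>

definition emb :: "real \<Rightarrow> real \<Rightarrow> complex \<Rightarrow> point" where
  "emb a b z = (a * Re z, b * Im z)"

lemma emb_simps:
  "emb a b (z + w) = emb a b z + emb a b w" "emb a b (z - w) = emb a b z - emb a b w"
  "emb a b (t *\<^sub>R z) = t *\<^sub>R emb a b z"
  by (simp_all add: emb_def algebra_simps)

lemma emb_inverse: "a > 0 \<Longrightarrow> b > 0 \<Longrightarrow> emb a b (Complex (fst P / a) (snd P / b)) = P"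
  by (simp add: emb_def)

lemma emb_cancel: "a > 0 \<Longrightarrow> b > 0 \<Longrightarrow> emb a b z = emb a b w \<longleftrightarrow> z = w"
  by (auto simp: emb_def complex_eq_iff)

lemma emb_interior_iff:
  assumes "a > 0" "b > 0"
  shows "emb a b z \<in> ellipse_interior (0, 0) a b \<longleftrightarrow> cmod z < 1"
  using assms by (simp add: emb_def ellipse_interior_def power_mult_distrib cmod_def)

lemma emb_mem_ellipse_iff:
  assumes "a > 0" "b > 0"
  shows "emb a b z \<in> ellipse (0, 0) a b \<longleftrightarrow> cmod z = 1"
  using assms by (simp add: emb_def ellipse_def power_mult_distrib cmod_def)

text \<open>For \<open>k = 0\<close> this rests on the convention in \<open>ellipse\<close>: both
  sides are the origin alone.\<close>

lemma ellipse_eq_emb_sphere: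
  assumes "a > 0" "b > 0" "k \<ge> 0"
  shows "ellipse (0, 0) (k * a) (k * b) = emb a b ` sphere 0 k"
proof (cases "k = 0")
  case True
  then show ?thesis by (simp add: ellipse_def emb_def)
next
  case False
  with assms(3) have k: "k > 0" by simp
  have mem: "emb a b z \<in> ellipse (0, 0) (k * a) (k * b) \<longleftrightarrow> cmod z = k" for z
  proof -
    have "emb a b z \<in> ellipse (0, 0) (k * a) (k * b) \<longleftrightarrow> (Re z)\<^sup>2 / k\<^sup>2 + (Im z)\<^sup>2 / k\<^sup>2 = 1"
      using assms k by (simp add: emb_def ellipse_def power_mult_distrib)
    also have "\<dots> \<longleftrightarrow> (Re z)\<^sup>2 + (Im z)\<^sup>2 = k\<^sup>2"
      using k by (auto simp: field_simps)
    also have "\<dots> \<longleftrightarrow> cmod z = k"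
      using k by (metis cmod_power2 norm_ge_zero less_imp_le power2_eq_iff_nonneg)
    finally show ?thesis .
  qed
  show ?thesis
  proof (intro equalityI subsetI)
    fix P assume "P \<in> ellipse (0, 0) (k * a) (k * b)"
    then show "P \<in> emb a b ` sphere 0 k"
      using emb_inverse[OF assms(1,2), of P] mem by (metis image_eqI mem_sphere_0)
  next
    fix P assume "P \<in> emb a b ` sphere 0 k"
    then obtain z where "P = emb a b z" "cmod z = k" by (metis imageE mem_sphere_0)
    then show "P \<in> ellipse (0, 0) (k * a) (k * b)" using mem by blast
  qed
qed

lemma scale_ellipse:
  assumes "a > 0" "b > 0" "k \<ge> 0"
  shows "(\<lambda>P. k *\<^sub>R P) ` ellipse (0, 0) a b = ellipse (0, 0) (k * a) (k * b)"
proof -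
  have "(\<lambda>P. k *\<^sub>R P) ` ellipse (0, 0) a b = (\<lambda>P. k *\<^sub>R P) ` emb a b ` sphere 0 1"
    using ellipse_eq_emb_sphere[OF assms(1,2), of 1] by simp
  also have "\<dots> = emb a b ` (\<lambda>z. k *\<^sub>R z) ` sphere 0 1"
    by (simp add: image_image emb_simps)
  also have "(\<lambda>z. k *\<^sub>R z) ` sphere 0 1 = sphere (0 :: complex) k"
  proof (intro equalityI subsetI)
    fix z :: complex assume z: "z \<in> sphere 0 k"
    show "z \<in> (\<lambda>z. k *\<^sub>R z) ` sphere 0 1"
    proof (cases "k = 0")
      case True
      with z show ?thesis by (auto intro!: image_eqI[of _ _ 1])
    next
      case False
      with z assms(3) show ?thesis by (intro image_eqI[of _ _ "inverse k *\<^sub>R z"]) auto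
    qed
  qed (use assms(3) in auto)
  finally show ?thesis using ellipse_eq_emb_sphere[OF assms] by simp
qed

text \<open>Strict convexity of the disc. It will show that a nested circle touches each side line
  between the vertices.\<close>

lemma chord_point_in_open_segment:
  assumes ab: "a > 0" "b > 0" and A: "A \<in> ellipse (0, 0) a b" and B: "B \<in> ellipse (0, 0) a b"
    and T: "T \<in> affine hull {A, B}" "T \<in> ellipse_interior (0, 0) a b"
  shows "T \<in> open_segment A B"
proof -
  obtain z w where z: "A = emb a b z" "cmod z = 1" and w: "B = emb a b w" "cmod w = 1"
    using A B emb_mem_ellipse_iff[OF ab] emb_inverse[OF ab] by metis
  obtain t where t: "T = A + t *\<^sub>R (B - A)" using T(1) unfolding mem_line_iff ..
  have "T = emb a b (z + t *\<^sub>R (w - z))" by (simp add: t z w emb_simps)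
  then have "cmod (z + t *\<^sub>R (w - z)) < 1" using T(2) emb_interior_iff[OF ab] by simp
  then have "(cmod (z + t *\<^sub>R (w - z)))\<^sup>2 < 1" by (simp add: power_less_one_iff)
  \<comment> \<open>Stewart's theorem. With both ends on the unit circle, a modulus below 1 forces
    \<open>t * (1 - t)\<close> to be positive.\<close>
  moreover have "(cmod (z + t *\<^sub>R (w - z)))\<^sup>2 =
      (1 - t) * (cmod z)\<^sup>2 + t * (cmod w)\<^sup>2 - t * (1 - t) * (cmod (w - z))\<^sup>2"
    unfolding cmod_power2 by (simp add: algebra_simps power2_eq_square)
  ultimately have "0 < t * (1 - t) * (cmod (w - z))\<^sup>2" using z w by simp
  then have "0 < t * (1 - t)" "w \<noteq> z" by (auto simp: zero_less_mult_iff)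
  then have "0 < t" "t < 1" "A \<noteq> B"
    using z w emb_cancel[OF ab] by (auto simp: zero_less_mult_iff)
  then show ?thesis
    unfolding in_segment t by (auto intro!: exI[of _ t] simp: algebra_simps)
qed

text \<open>The chord of the unit circle through \<open>z\<close> and \<open>w\<close> has the equation \<open>Z + z w cnj Z = z + w\<close>.
  The form is the condition for this line to touch the ellipse with centre \<open>m\<close> and semi-axes
  \<open>r / a\<close>, \<open>r / b\<close>, where \<open>D = r\<^sup>2 / b\<^sup>2 - r\<^sup>2 / a\<^sup>2\<close> and \<open>S = r\<^sup>2 / a\<^sup>2 + r\<^sup>2 / b\<^sup>2\<close>; the foci of that
  ellipse are \<open>m + i sqrt D\<close> and \<open>m - i sqrt D\<close>.\<close>
definition chord_form :: "complex \<Rightarrow> real \<Rightarrow> real \<Rightarrow> complex \<Rightarrow> complex \<Rightarrow> complex" where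
  "chord_form m D S z w =
     (z + w - m - z * w * cnj m)\<^sup>2 + of_real D * ((z * w)\<^sup>2 + 1) - 2 * of_real S * (z * w)"

text \<open>The squared distance condition becomes polynomial in \<open>z\<close> and
  \<open>w\<close> because \<open>cnj z = 1 / z\<close> on the unit circle.\<close>

lemma tangent_chord_iff:
  assumes ab: "a > 0" "b > 0" and r: "r > 0" and zw: "cmod z = 1" "cmod w = 1" "z \<noteq> w"
    and D: "D = r\<^sup>2 / b\<^sup>2 - r\<^sup>2 / a\<^sup>2" and S: "S = r\<^sup>2 / a\<^sup>2 + r\<^sup>2 / b\<^sup>2"
  shows "(\<exists>T. tangent_at (emb a b z) (emb a b w) (emb a b m) r T) \<longleftrightarrow> chord_form m D S z w = 0"
proof -
  define \<kappa> where "\<kappa> = Re (z - m) * Im (w - m) - Im (z - m) * Re (w - m)"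
  define d p where "d = w - z" and "p = z * w"
  have zc: "z * cnj z = 1" and wc: "w * cnj w = 1"
    using zw by (simp_all add: complex_norm_square[symmetric])
  have nz: "d \<noteq> 0" "p \<noteq> 0" using zw by (auto simp: d_def p_def)
  have k: "2 * \<i> * of_real \<kappa> = cnj (z - m) * (w - m) - (z - m) * cnj (w - m)"
    by (simp add: \<kappa>_def complex_eq_iff algebra_simps)
  \<comment> \<open>Since \<open>cnj d = - d / p\<close>, multiplication by \<open>p\<close> turns
    each of these real quantities into a multiple of \<open>d\<close>; the nonzero factor
    \<open>d\<^sup>2\<close> can later be cancelled.\<close>
  have h1: "2 * \<i> * of_real \<kappa> * p = d * (z + w - m - p * cnj m)"
    unfolding k d_def p_def complex_cnj_diff using zc wc by algebra
  have "2 * of_real (Re d) = d + cnj d" "2 * \<i> * of_real (Im d) = d - cnj d"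
    by (simp_all add: complex_eq_iff)
  then have h2: "2 * of_real (Re d) * p = d * (p - 1)" and h3: "2 * \<i> * of_real (Im d) * p = d * (p + 1)"
    unfolding d_def p_def complex_cnj_diff using zc wc by algebra+
  define A B where "A = complex_of_real (r\<^sup>2 / a\<^sup>2)" and "B = complex_of_real (r\<^sup>2 / b\<^sup>2)"
  have DS: "of_real D = B - A" "of_real S = A + B" unfolding A_def B_def D S by simp_all
  have "d\<^sup>2 * chord_form m D S z w
      = 4 * p\<^sup>2 * (B * (of_real (Re d))\<^sup>2 + A * (of_real (Im d))\<^sup>2 - (of_real \<kappa>)\<^sup>2)"
    unfolding chord_form_def DS p_def[symmetric] using h1 h2 h3 i_squared by algebra
  also have "\<dots> = 4 * p\<^sup>2 * of_real (r\<^sup>2 / b\<^sup>2 * (Re d)\<^sup>2 + r\<^sup>2 / a\<^sup>2 * (Im d)\<^sup>2 - \<kappa>\<^sup>2)"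
    by (simp add: A_def B_def)
  finally have "chord_form m D S z w = 0 \<longleftrightarrow> r\<^sup>2 / b\<^sup>2 * (Re d)\<^sup>2 + r\<^sup>2 / a\<^sup>2 * (Im d)\<^sup>2 - \<kappa>\<^sup>2 = 0"
    using nz by (metis mult_eq_0_iff of_real_eq_0_iff power_not_zero zero_neq_numeral)
  also have "\<dots> \<longleftrightarrow> (a * b * \<kappa>)\<^sup>2 = r\<^sup>2 * ((a * Re d)\<^sup>2 + (b * Im d)\<^sup>2)"
  proof -
    have "(a * b)\<^sup>2 * (r\<^sup>2 / b\<^sup>2 * (Re d)\<^sup>2 + r\<^sup>2 / a\<^sup>2 * (Im d)\<^sup>2 - \<kappa>\<^sup>2)
        = r\<^sup>2 * ((a * Re d)\<^sup>2 + (b * Im d)\<^sup>2) - (a * b * \<kappa>)\<^sup>2"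
      using ab by (simp add: power_mult_distrib algebra_simps)
    moreover have "(a * b)\<^sup>2 \<noteq> 0" using ab by simp
    ultimately show ?thesis by (metis eq_iff_diff_eq_0 mult_eq_0_iff)
  qed
  also have "a * b * \<kappa> = cross (emb a b z - emb a b m) (emb a b w - emb a b m)"
    by (simp add: \<kappa>_def emb_def cross_def algebra_simps)
  also have "(a * Re d)\<^sup>2 + (b * Im d)\<^sup>2 = (norm (emb a b w - emb a b z))\<^sup>2"
    by (simp add: d_def norm_Pair flip: emb_simps) (simp add: emb_def norm_Pair)
  finally show ?thesis
    using ex_tangent_at_iff r zw(3) emb_cancel[OF ab] by metis
qed

lemma chord_form_commute: "chord_form m D S z w = chord_form m D S w z"
  by (simp add: chord_form_def algebra_simps)

text \<open>As a quadratic in \<open>w\<close>, the form has leading coefficient \<open>(1 - cnj m z)\<^sup>2 + D z\<^sup>2\<close> and constant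
  term \<open>(z - m)\<^sup>2 + D\<close>, so the product of the three vertices is the value at each of them of the
  Blaschke product with zeros \<open>0\<close> and the foci.\<close>
lemma chord_form_triangle:
  assumes nz: "z\<^sub>1 \<noteq> 0" and ne: "z\<^sub>1 \<noteq> z\<^sub>2" "z\<^sub>2 \<noteq> z\<^sub>3" "z\<^sub>3 \<noteq> z\<^sub>1"
    and zero: "chord_form m D S z\<^sub>1 z\<^sub>2 = 0" "chord_form m D S z\<^sub>2 z\<^sub>3 = 0" "chord_form m D S z\<^sub>3 z\<^sub>1 = 0"
  shows "z\<^sub>1 + z\<^sub>2 + z\<^sub>3 = 2 * m + z\<^sub>1 * z\<^sub>2 * z\<^sub>3 * cnj (m\<^sup>2 + of_real D)"
    and "(cmod (m\<^sup>2 + of_real D))\<^sup>2 = 2 * (cmod m)\<^sup>2 - 1 + 2 * S"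
proof -
  define m' d s where "m' = cnj m" and "d = complex_of_real D" and "s = complex_of_real S"
  define Q where "Q = m\<^sup>2 + d"
  have Q': "cnj Q = m'\<^sup>2 + d" by (simp add: Q_def m'_def d_def)
  \<comment> \<open>\<open>y\<close> and \<open>z\<close> are distinct roots of one quadratic with
    coefficients depending on \<open>x\<close>. Subtracting and cancelling \<open>y - z\<close>
    gives Vieta's formulas without dividing by the leading coefficient.\<close>
  have vieta: "((1 - m' * x)\<^sup>2 + d * x\<^sup>2) * (y + z) = 2 * (m - x) * (1 - m' * x) + 2 * s * x
      \<and> ((1 - m' * x)\<^sup>2 + d * x\<^sup>2) * (y * z) = (x - m)\<^sup>2 + d"
    if "chord_form m D S x y = 0" "chord_form m D S x z = 0" "y \<noteq> z" for x y z
  proof -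
    have y: "((1 - m' * x)\<^sup>2 + d * x\<^sup>2) * y\<^sup>2 + (x - m)\<^sup>2 + d = (2 * (m - x) * (1 - m' * x) + 2 * s * x) * y"
      using that(1) unfolding chord_form_def m'_def[symmetric] d_def[symmetric] s_def[symmetric] by algebra
    have z: "((1 - m' * x)\<^sup>2 + d * x\<^sup>2) * z\<^sup>2 + (x - m)\<^sup>2 + d = (2 * (m - x) * (1 - m' * x) + 2 * s * x) * z"
      using that(2) unfolding chord_form_def m'_def[symmetric] d_def[symmetric] s_def[symmetric] by algebra
    have "(y - z) * (((1 - m' * x)\<^sup>2 + d * x\<^sup>2) * (y + z)) = (y - z) * (2 * (m - x) * (1 - m' * x) + 2 * s * x)"
      using y z by algebra
    then have sum: "((1 - m' * x)\<^sup>2 + d * x\<^sup>2) * (y + z) = 2 * (m - x) * (1 - m' * x) + 2 * s * x"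
      using that(3) by simp
    moreover have "((1 - m' * x)\<^sup>2 + d * x\<^sup>2) * (y * z) = (x - m)\<^sup>2 + d"
      using sum y by algebra
    ultimately show ?thesis ..
  qed
  define l where "l = z\<^sub>1 * z\<^sub>2 * z\<^sub>3"
  define \<alpha> \<beta> where "\<alpha> = 2 * m + l * (m'\<^sup>2 + d)" and "\<beta> = m\<^sup>2 + d + 2 * l * m'"
  note v = vieta[OF zero(1) zero(3)[unfolded chord_form_commute[of m D S z\<^sub>3 z\<^sub>1]] ne(2)]
    vieta[OF zero(2) zero(1)[unfolded chord_form_commute[of m D S z\<^sub>1 z\<^sub>2]] ne(3)]
    vieta[OF zero(3) zero(2)[unfolded chord_form_commute[of m D S z\<^sub>2 z\<^sub>3]] ne(1)]
  \<comment> \<open>Multiplying the product formula at a vertex by that vertex brings in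
    \<open>l\<close>, which is common to all three, so they satisfy one cubic.\<close>
  have cubic: "z\<^sub>1^3 - \<alpha> * z\<^sub>1\<^sup>2 + \<beta> * z\<^sub>1 - l = 0" "z\<^sub>2^3 - \<alpha> * z\<^sub>2\<^sup>2 + \<beta> * z\<^sub>2 - l = 0"
    "z\<^sub>3^3 - \<alpha> * z\<^sub>3\<^sup>2 + \<beta> * z\<^sub>3 - l = 0"
    using v[THEN conjunct2] unfolding \<alpha>_def \<beta>_def l_def by algebra+
  \<comment> \<open>Divided differences, taken twice, extract the sum of the three distinct
    roots.\<close>
  have "(z\<^sub>1 - z\<^sub>2) * (z\<^sub>1\<^sup>2 + z\<^sub>1 * z\<^sub>2 + z\<^sub>2\<^sup>2 - \<alpha> * (z\<^sub>1 + z\<^sub>2) + \<beta>) = 0"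
    "(z\<^sub>3 - z\<^sub>1) * (z\<^sub>1\<^sup>2 + z\<^sub>1 * z\<^sub>3 + z\<^sub>3\<^sup>2 - \<alpha> * (z\<^sub>1 + z\<^sub>3) + \<beta>) = 0"
    using cubic by algebra+
  then have "z\<^sub>1\<^sup>2 + z\<^sub>1 * z\<^sub>2 + z\<^sub>2\<^sup>2 - \<alpha> * (z\<^sub>1 + z\<^sub>2) + \<beta> = 0" "z\<^sub>1\<^sup>2 + z\<^sub>1 * z\<^sub>3 + z\<^sub>3\<^sup>2 - \<alpha> * (z\<^sub>1 + z\<^sub>3) + \<beta> = 0"
    using ne by simp_all
  then have "(z\<^sub>2 - z\<^sub>3) * (z\<^sub>1 + z\<^sub>2 + z\<^sub>3 - \<alpha>) = 0" by algebra
  then have sum: "z\<^sub>1 + z\<^sub>2 + z\<^sub>3 = \<alpha>" using ne by simp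
  then show "z\<^sub>1 + z\<^sub>2 + z\<^sub>3 = 2 * m + z\<^sub>1 * z\<^sub>2 * z\<^sub>3 * cnj (m\<^sup>2 + of_real D)"
    using Q' by (simp add: \<alpha>_def l_def Q_def d_def)
  \<comment> \<open>The sum of the other two vertices is known from the quadratic at
    \<open>z\<^sub>1\<close> and from the cubic. Comparing both leaves the closure condition, free
    of the vertices.\<close>
  have "z\<^sub>1 * ((m\<^sup>2 + d) * (m'\<^sup>2 + d) - 2 * (m * m') + 1 - 2 * s) = 0"
    using v(1) sum unfolding \<alpha>_def l_def by algebra
  then have "(m\<^sup>2 + d) * (m'\<^sup>2 + d) - 2 * (m * m') + 1 - 2 * s = 0"
    using nz unfolding mult_eq_0_iff by blast
  then have "Q * cnj Q = 2 * (m * cnj m) - 1 + 2 * s"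
    unfolding Q' unfolding Q_def m'_def by algebra
  then have "complex_of_real ((cmod Q)\<^sup>2) = of_real (2 * (cmod m)\<^sup>2 - 1 + 2 * S)"
    unfolding complex_norm_square[symmetric] s_def by simp
  then show "(cmod (m\<^sup>2 + of_real D))\<^sup>2 = 2 * (cmod m)\<^sup>2 - 1 + 2 * S"
    unfolding Q_def d_def using of_real_eq_iff by blast
qed

text \<open>Converse direction: the other two roots have the sum and product prescribed by the
  quadratic at \<open>z\<^sub>1\<close>, so they solve it. Repeated roots are allowed here.\<close>

lemma chord_form_of_roots:
  assumes nz: "z\<^sub>1 \<noteq> 0"
    and sum: "z\<^sub>1 + z\<^sub>2 + z\<^sub>3 = 2 * m + z\<^sub>1 * z\<^sub>2 * z\<^sub>3 * cnj (m\<^sup>2 + of_real D)"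
    and sum2: "z\<^sub>1 * z\<^sub>2 + z\<^sub>1 * z\<^sub>3 + z\<^sub>2 * z\<^sub>3 = m\<^sup>2 + of_real D + 2 * (z\<^sub>1 * z\<^sub>2 * z\<^sub>3) * cnj m"
    and QQ: "(cmod (m\<^sup>2 + of_real D))\<^sup>2 = 2 * (cmod m)\<^sup>2 - 1 + 2 * S"
  shows "chord_form m D S z\<^sub>1 z\<^sub>2 = 0"
proof -
  define m' d s where "m' = cnj m" and "d = complex_of_real D" and "s = complex_of_real S"
  define l where "l = z\<^sub>1 * z\<^sub>2 * z\<^sub>3"
  have sum': "z\<^sub>1 + z\<^sub>2 + z\<^sub>3 = 2 * m + l * (m'\<^sup>2 + d)"
    using sum by (simp add: m'_def d_def l_def)
  have sum2': "z\<^sub>1 * z\<^sub>2 + z\<^sub>1 * z\<^sub>3 + z\<^sub>2 * z\<^sub>3 = m\<^sup>2 + d + 2 * l * m'"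
    using sum2 by (simp add: m'_def d_def l_def)
  have "(m\<^sup>2 + of_real D) * cnj (m\<^sup>2 + of_real D) = 2 * complex_of_real ((cmod m)\<^sup>2) - 1 + 2 * of_real S"
    unfolding complex_norm_square[symmetric] QQ by simp
  then have "(m\<^sup>2 + of_real D) * cnj (m\<^sup>2 + of_real D) = 2 * (m * cnj m) - 1 + 2 * of_real S"
    unfolding complex_norm_square .
  then have QQ': "(m\<^sup>2 + d) * (m'\<^sup>2 + d) = 2 * (m * m') - 1 + 2 * s"
    by (simp add: m'_def d_def s_def)
  have cubic: "z\<^sub>1 * ((z\<^sub>1 - m)\<^sup>2 + d) = l * ((1 - m' * z\<^sub>1)\<^sup>2 + d * z\<^sub>1\<^sup>2)"
    using sum' sum2' l_def by algebra
  then have "z\<^sub>1 * (((1 - m' * z\<^sub>1)\<^sup>2 + d * z\<^sub>1\<^sup>2) * (z\<^sub>2 * z\<^sub>3)) = z\<^sub>1 * ((z\<^sub>1 - m)\<^sup>2 + d)"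
    unfolding l_def by algebra
  then have prod: "((1 - m' * z\<^sub>1)\<^sup>2 + d * z\<^sub>1\<^sup>2) * (z\<^sub>2 * z\<^sub>3) = (z\<^sub>1 - m)\<^sup>2 + d" using nz by simp
  \<comment> \<open>The product needed only the cubic; for the sum the closure condition
    \<open>QQ'\<close> enters.\<close>
  have "((1 - m' * z\<^sub>1)\<^sup>2 + d * z\<^sub>1\<^sup>2) * (z\<^sub>2 + z\<^sub>3) = 2 * (m - z\<^sub>1) * (1 - m' * z\<^sub>1) + 2 * s * z\<^sub>1"
    using sum' cubic QQ' by algebra
  then show ?thesis
    using prod unfolding chord_form_def m'_def[symmetric] d_def[symmetric] s_def[symmetric] by algebra
qed

section \<open>Unimodular roots of the cubic\<close>

lemma cubic_splits:
  fixes \<alpha> \<beta> \<gamma> :: complex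
  obtains x y z where "x + y + z = \<alpha>" "x * y + x * z + y * z = \<beta>" "x * y * z = \<gamma>"
proof -
  have "\<not> constant (poly [:- \<gamma>, \<beta>, - \<alpha>, 1:])"
    using constant_degree[of "[:- \<gamma>, \<beta>, - \<alpha>, 1:]"] by simp
  then obtain x where "poly [:- \<gamma>, \<beta>, - \<alpha>, 1:] x = 0"
    using fundamental_theorem_of_algebra by blast
  then have x: "x * (\<beta> - x * (\<alpha> - x)) = \<gamma>" by (simp add: algebra_simps)
  \<comment> \<open>A root of the discriminant of the quadratic factor left after splitting off
    \<open>x\<close>.\<close>
  define q where "q = csqrt ((\<alpha> - x)\<^sup>2 - 4 * (\<beta> - x * (\<alpha> - x)))"
  have q: "q\<^sup>2 = (\<alpha> - x)\<^sup>2 - 4 * (\<beta> - x * (\<alpha> - x))" by (simp add: q_def)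
  define y z where "y = (\<alpha> - x + q) / 2" and "z = (\<alpha> - x - q) / 2"
  have "4 * (y * z) = (\<alpha> - x)\<^sup>2 - q\<^sup>2"
    by (simp add: y_def z_def field_simps power2_eq_square)
  then have "4 * (y * z) = 4 * (\<beta> - x * (\<alpha> - x))" using q by algebra
  then have yz: "y * z = \<beta> - x * (\<alpha> - x)" by (metis mult_cancel_left zero_neq_numeral)
  have sum: "y + z = \<alpha> - x" by (simp add: y_def z_def field_simps)
  show ?thesis
  proof
    show "x + y + z = \<alpha>" using sum by (simp add: algebra_simps)
    show "x * y + x * z + y * z = \<beta>" using sum yz by algebra
    show "x * y * z = \<gamma>" using yz x by (simp add: mult.assoc)
  qed
qed

text \<open>For \<open>cmod f < 1\<close> the sign is that of \<open>1 - cmod z\<close>: the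
  Blaschke factor with zero \<open>f\<close> preserves the disc and its exterior.\<close>

lemma blaschke_factor: "(cmod (1 - cnj f * z))\<^sup>2 - (cmod (z - f))\<^sup>2 = (1 - (cmod f)\<^sup>2) * (1 - (cmod z)\<^sup>2)"
  unfolding cmod_power2 by (simp add: algebra_simps power2_eq_square)

text \<open>The Blaschke product with zeros \<open>0\<close>, \<open>f\<close>, \<open>g\<close> has
  modulus below 1 in the disc and above 1 outside, so it takes unimodular values only on the circle.
  Clearing denominators avoids its poles.\<close>

lemma blaschke_unimodular:
  assumes fg: "cmod f < 1" "cmod g < 1" and l: "cmod l = 1"
    and eq: "z * (z - f) * (z - g) = l * ((1 - cnj f * z) * (1 - cnj g * z))"
  shows "cmod z = 1"
proof -
  have n: "cmod z * (cmod (z - f) * cmod (z - g)) = cmod (1 - cnj f * z) * cmod (1 - cnj g * z)"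
    using arg_cong[OF eq, of cmod] l by (simp add: norm_mult mult.assoc)
  have pos: "0 < 1 - (cmod h)\<^sup>2" if "cmod h < 1" for h
    using that by (simp add: power_less_one_iff)
  consider "cmod z < 1" | "cmod z = 1" | "cmod z > 1" by linarith
  then show ?thesis
  proof cases
    case 1
    have lt: "cmod (z - h) < cmod (1 - cnj h * z)" if "cmod h < 1" for h
    proof (rule power2_less_imp_less)
      show "(cmod (z - h))\<^sup>2 < (cmod (1 - cnj h * z))\<^sup>2"
        using blaschke_factor[of h z] mult_pos_pos[OF pos[OF that] pos[OF 1]] by linarith
    qed simp
    have "cmod z * (cmod (z - f) * cmod (z - g)) \<le> cmod (z - f) * cmod (z - g)"
      using 1 by (simp add: mult_left_le_one_le)
    also have "\<dots> < cmod (1 - cnj f * z) * cmod (1 - cnj g * z)"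
      using lt fg by (intro mult_strict_mono') auto
    finally show ?thesis using n by simp
  next
    case 3
    then have neg: "1 - (cmod z)\<^sup>2 < 0" by (simp add: one_less_power)
    have lt: "cmod (1 - cnj h * z) < cmod (z - h)" if "cmod h < 1" for h
    proof (rule power2_less_imp_less)
      show "(cmod (1 - cnj h * z))\<^sup>2 < (cmod (z - h))\<^sup>2"
        using blaschke_factor[of h z] mult_pos_neg[OF pos[OF that] neg] by linarith
    qed simp
    have "cmod (1 - cnj f * z) * cmod (1 - cnj g * z) < cmod (z - f) * cmod (z - g)"
      using lt fg by (intro mult_strict_mono') auto
    also have "\<dots> \<le> cmod z * (cmod (z - f) * cmod (z - g))"
      using 3 mult_right_mono[of 1 "cmod z" "cmod (z - f) * cmod (z - g)"] by simp
    finally show ?thesis using n by simp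
  qed
qed

section \<open>Nested circles\<close>

text \<open>The squared distances differ by \<open>(\<rho> - 1)\<^sup>2\<close> plus a nonnegative
  multiple of \<open>1 - Re (z * cnj h)\<close>.\<close>

lemma norm_diff_projection_le:
  assumes "cmod h < 1" "cmod z = 1" "\<rho> \<ge> 1"
  shows "cmod (z - h) \<le> cmod (of_real \<rho> * z - h)"
proof (rule power2_le_imp_le)
  define t where "t = Re z * Re h + Im z * Im h"
  have "t = Re (z * cnj h)" by (simp add: t_def)
  also have "\<dots> \<le> cmod (z * cnj h)" by (rule complex_Re_le_cmod)
  also have "\<dots> \<le> 1" using assms by (simp add: norm_mult)
  finally have t: "t \<le> 1" .
  have "(cmod z)\<^sup>2 = 1" using assms by simp
  then have z: "(Re z)\<^sup>2 + (Im z)\<^sup>2 = 1" unfolding cmod_power2 .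
  have "(cmod (of_real \<rho> * z - h))\<^sup>2 - (cmod (z - h))\<^sup>2
      = (\<rho>\<^sup>2 - 1) * ((Re z)\<^sup>2 + (Im z)\<^sup>2) - 2 * (\<rho> - 1) * t"
    unfolding cmod_power2 t_def by (simp add: algebra_simps power2_eq_square)
  also have "\<dots> = (\<rho> - 1)\<^sup>2 + 2 * (\<rho> - 1) * (1 - t)"
    unfolding z by (simp add: algebra_simps power2_eq_square)
  also have "\<dots> \<ge> 0" using t assms(3) by simp
  finally show "(cmod (z - h))\<^sup>2 \<le> (cmod (of_real \<rho> * z - h))\<^sup>2" by simp
qed simp

text \<open>Thus an ellipse with foci \<open>f\<close>, \<open>g\<close> and major axis
  \<open>cmod (1 - cnj f * g)\<close> lies in the open disc. Radial projection reduces to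
  \<open>cmod Z = 1\<close>, where a splitting of \<open>1 - cnj f * g\<close> and the triangle
  inequality apply; \<open>cmod g < 1\<close> makes the bound strict.\<close>

lemma focal_sum_outside_disc:
  assumes f: "cmod f < 1" and g: "cmod g < 1" and Z: "cmod Z \<ge> 1"
  shows "cmod (1 - cnj f * g) < cmod (Z - f) + cmod (Z - g)"
proof -
  define z where "z = sgn Z"
  have "Z \<noteq> 0" using Z by auto
  then have z: "cmod z = 1" "Z = of_real (cmod Z) * z"
    by (simp_all add: z_def norm_sgn sgn_div_norm flip: scaleR_conv_of_real)
  have zc: "cnj z * z = 1"
    using z(1) by (metis complex_norm_square mult.commute of_real_1 power_one)
  have "1 - cnj f * g = cnj z * (z - g) + cnj (z - f) * g"
    using zc by (simp add: algebra_simps)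
  then have "cmod (1 - cnj f * g) \<le> cmod (z - g) + cmod (z - f) * cmod g"
    using z(1) norm_triangle_ineq[of "cnj z * (z - g)" "cnj (z - f) * g"]
    by (simp add: norm_mult flip: complex_cnj_diff)
  moreover have "z \<noteq> f" using z(1) f by auto
  then have "cmod (z - f) * cmod g < cmod (z - f)" using g by simp
  moreover have "cmod (z - f) \<le> cmod (Z - f)" "cmod (z - g) \<le> cmod (Z - g)"
    using norm_diff_projection_le[OF f z(1) Z] norm_diff_projection_le[OF g z(1) Z] z(2) by simp_all
  ultimately show ?thesis by linarith
qed

lemma dist_emb_sq: "(dist (emb a b z) (emb a b w))\<^sup>2 = (a * Re (w - z))\<^sup>2 + (b * Im (w - z))\<^sup>2"
  by (simp add: emb_def dist_Pair_Pair dist_real_def) (simp add: algebra_simps power2_eq_square)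

text \<open>The circle pulls back to the ellipse with foci \<open>f\<close>, \<open>g\<close> and
  major axis \<open>2 * (r / b)\<close>; the premise \<open>fg\<close> says that this is the bound
  of \<open>focal_sum_outside_disc\<close>.\<close>

lemma circle_nested:
  assumes ab: "a > b" "b > 0" and r: "r > 0" and D: "D = r\<^sup>2 / b\<^sup>2 - r\<^sup>2 / a\<^sup>2"
    and f: "f = m + \<i> * of_real (sqrt D)" "cmod f < 1"
    and g: "g = m - \<i> * of_real (sqrt D)" "cmod g < 1"
    and fg: "(cmod (1 - cnj f * g))\<^sup>2 = 4 * (r\<^sup>2 / b\<^sup>2)"
  shows "sphere (emb a b m) r \<subseteq> ellipse_interior (0, 0) a b"
proof
  fix P assume P: "P \<in> sphere (emb a b m) r"
  have a: "a > 0" using ab by simp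
  obtain Z where Z: "P = emb a b Z" using emb_inverse[OF a ab(2)] by metis
  define X Y h where "X = a * Re (Z - m)" and "Y = b * Im (Z - m)" and "h = sqrt D"
  have XY: "X\<^sup>2 + Y\<^sup>2 = r\<^sup>2"
    using P dist_emb_sq[of a b m Z] by (simp add: Z X_def Y_def)
  have "r\<^sup>2 / a\<^sup>2 \<le> r\<^sup>2 / b\<^sup>2"
    using ab r by (intro divide_left_mono) (auto intro: power_mono)
  then have h: "h\<^sup>2 = r\<^sup>2 / b\<^sup>2 - r\<^sup>2 / a\<^sup>2" "h \<ge> 0"
    unfolding h_def D by simp_all
  have "h\<^sup>2 \<le> (r / b)\<^sup>2" using h(1) a by (simp add: power_divide)
  moreover have "0 \<le> r / b" using r ab by simp
  ultimately have hr: "h \<le> r / b" by (rule power2_le_imp_le)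
  have "Y\<^sup>2 \<le> r\<^sup>2" using XY by (metis le_add_same_cancel2 zero_le_power2)
  then have "\<bar>Y\<bar> \<le> r" using r by (metis abs_le_square_iff abs_of_pos)
  then have "\<bar>Y\<bar> * h \<le> r * (r / b)" using h hr r by (intro mult_mono) auto
  then have Yh: "\<bar>Y * h / r\<bar> \<le> r / b" using r h(2) by (simp add: abs_mult field_simps)
  have ReIm: "Re (Z - m) = X / a" "Im (Z - m) = Y / b" using a ab by (simp_all add: X_def Y_def)
  \<comment> \<open>Focal radius formula: semi-major axis minus eccentricity times the coordinate
    along the vertical major axis. The signs \<open>s = 1\<close> and \<open>s = -1\<close> select
    the foci.\<close>
  have focal: "cmod (Z - (m + \<i> * of_real (s * h))) = r / b - s * (Y * h / r)" if s: "s\<^sup>2 = 1" for s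
  proof (rule power2_eq_imp_eq)
    have re: "Re (Z - (m + \<i> * of_real (s * h))) = X / a"
      and im: "Im (Z - (m + \<i> * of_real (s * h))) = Y / b - s * h"
      unfolding ReIm[symmetric] by simp_all
    have "(cmod (Z - (m + \<i> * of_real (s * h))))\<^sup>2 = (X / a)\<^sup>2 + (Y / b - s * h)\<^sup>2"
      unfolding cmod_power2 re im ..
    also have "\<dots> = X\<^sup>2 / a\<^sup>2 + Y\<^sup>2 / b\<^sup>2 - 2 * s * Y * h / b + h\<^sup>2"
      using s by (simp add: power_divide power2_diff power_mult_distrib)
    also have "X\<^sup>2 = r\<^sup>2 - Y\<^sup>2" using XY by simp
    also have "(r\<^sup>2 - Y\<^sup>2) / a\<^sup>2 + Y\<^sup>2 / b\<^sup>2 - 2 * s * Y * h / b + h\<^sup>2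
        = r\<^sup>2 / b\<^sup>2 - 2 * s * Y * h / b + Y\<^sup>2 * (r\<^sup>2 / b\<^sup>2 - r\<^sup>2 / a\<^sup>2) / r\<^sup>2"
      unfolding h(1) using r by (simp add: algebra_simps diff_divide_distrib)
    also have "\<dots> = (r / b - s * (Y * h / r))\<^sup>2"
      unfolding h(1)[symmetric] using s r
      by (simp add: power2_diff power_divide power_mult_distrib)
    finally show "(cmod (Z - (m + \<i> * of_real (s * h))))\<^sup>2 = (r / b - s * (Y * h / r))\<^sup>2" .
    have "s = 1 \<or> s = -1" using s by (simp add: power2_eq_1_iff)
    moreover have "Y * h / r \<le> r / b" "- (Y * h / r) \<le> r / b" using Yh by linarith+
    ultimately show "r / b - s * (Y * h / r) \<ge> 0" by auto
  qed simp
  have "cmod (Z - f) + cmod (Z - g) = 2 * (r / b)"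
    using focal[of 1] focal[of "-1"] unfolding f g h_def[symmetric] by simp
  moreover have "cmod (1 - cnj f * g) = 2 * (r / b)"
  proof (rule power2_eq_imp_eq)
    show "(cmod (1 - cnj f * g))\<^sup>2 = (2 * (r / b))\<^sup>2"
      unfolding fg by (simp add: power_divide)
  qed (use r ab in simp_all)
  ultimately have "cmod Z < 1"
    using focal_sum_outside_disc[OF f(2) g(2), of Z] by linarith
  then show "P \<in> ellipse_interior (0, 0) a b" using emb_interior_iff[OF a ab(2)] Z by simp
qed

text \<open>A double vertex \<open>u\<close> would make the tangent of the unit circle at \<open>u\<close> touch the inner ellipse
  as well; the touching point is exhibited by means of the support function of that ellipse.\<close>
lemma chord_form_diagonal_nonzero:
  assumes ab: "a > 0" "b > 0" and r: "r > 0" and u: "cmod u = 1" and m: "cmod m < 1"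
    and D: "D = r\<^sup>2 / b\<^sup>2 - r\<^sup>2 / a\<^sup>2" and S: "S = r\<^sup>2 / a\<^sup>2 + r\<^sup>2 / b\<^sup>2"
    and nested: "sphere (emb a b m) r \<subseteq> ellipse_interior (0, 0) a b"
  shows "chord_form m D S u u \<noteq> 0"
proof
  assume zero: "chord_form m D S u u = 0"
  define x y where "x = Re u" and "y = Im u"
  have "(cmod u)\<^sup>2 = 1" using u by simp
  then have xy: "x\<^sup>2 + y\<^sup>2 = 1" unfolding cmod_power2 x_def y_def .
  define t where "t = Re m * x + Im m * y"
  have uc: "u * cnj u = 1" using u by (simp add: complex_norm_square[symmetric])
  have tt: "2 * complex_of_real t = m * cnj u + cnj m * u"
    by (simp add: t_def x_def y_def complex_eq_iff)
  have uu: "2 * complex_of_real (x\<^sup>2 - y\<^sup>2) = u\<^sup>2 + (cnj u)\<^sup>2"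
    by (simp add: x_def y_def complex_eq_iff power2_eq_square)
  \<comment> \<open>Multiplying by \<open>(cnj u)\<^sup>2\<close>, the inverse of
    \<open>u\<^sup>2\<close>, makes the form real.\<close>
  have "4 * (1 - complex_of_real t)\<^sup>2 + 2 * of_real D * of_real (x\<^sup>2 - y\<^sup>2) - 2 * of_real S
      = (cnj u)\<^sup>2 * chord_form m D S u u"
    unfolding chord_form_def using tt uu uc by algebra
  then have "complex_of_real (4 * (1 - t)\<^sup>2 + 2 * D * (x\<^sup>2 - y\<^sup>2) - 2 * S) = 0"
    unfolding zero by simp
  then have "4 * (1 - t)\<^sup>2 + 2 * D * (x\<^sup>2 - y\<^sup>2) - 2 * S = 0"
    unfolding of_real_eq_0_iff .
  then have q2: "(1 - t)\<^sup>2 = r\<^sup>2 / a\<^sup>2 * x\<^sup>2 + r\<^sup>2 / b\<^sup>2 * y\<^sup>2"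
    unfolding D S using xy by algebra
  have "t = Re (m * cnj u)" by (simp add: t_def x_def y_def)
  also have "\<dots> \<le> cmod (m * cnj u)" by (rule complex_Re_le_cmod)
  also have "\<dots> < 1" using m u by (simp add: norm_mult)
  finally have q: "1 - t > 0" by simp
  \<comment> \<open>\<open>q\<close> is the distance from \<open>m\<close> to the tangent line
    \<open>Re (Z * cnj u) = 1\<close>, and \<open>Z\<close> is the point of the inner ellipse with
    outer normal \<open>u\<close>.\<close>
  define q where "q = 1 - t"
  define Z where "Z = m + Complex (r\<^sup>2 * x / (a\<^sup>2 * q)) (r\<^sup>2 * y / (b\<^sup>2 * q))"
  have qpos: "q > 0" using q by (simp add: q_def)
  have q2': "q\<^sup>2 = r\<^sup>2 / a\<^sup>2 * x\<^sup>2 + r\<^sup>2 / b\<^sup>2 * y\<^sup>2" using q2 by (simp add: q_def)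
  have "(dist (emb a b m) (emb a b Z))\<^sup>2 = (r\<^sup>2 * x / (a * q))\<^sup>2 + (r\<^sup>2 * y / (b * q))\<^sup>2"
    unfolding dist_emb_sq using ab by (simp add: Z_def power2_eq_square)
  also have "\<dots> = r\<^sup>2 * (r\<^sup>2 / a\<^sup>2 * x\<^sup>2 + r\<^sup>2 / b\<^sup>2 * y\<^sup>2) / q\<^sup>2"
    unfolding distrib_left add_divide_distrib by (simp add: power2_eq_square mult_ac)
  also have "\<dots> = r\<^sup>2" unfolding q2'[symmetric] using qpos by simp
  finally have "emb a b Z \<in> sphere (emb a b m) r" using r by simp
  then have "cmod Z < 1" using nested emb_interior_iff[OF ab] by blast
  moreover have "Re (Z * cnj u) = t + (r\<^sup>2 / a\<^sup>2 * x\<^sup>2 + r\<^sup>2 / b\<^sup>2 * y\<^sup>2) / q"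
    using ab qpos by (simp add: Z_def t_def x_def y_def field_simps power2_eq_square)
  then have "Re (Z * cnj u) = 1"
    unfolding q2'[symmetric] using qpos by (simp add: power2_eq_square) (simp add: q_def)
  then have "1 \<le> cmod (Z * cnj u)" using complex_Re_le_cmod[of "Z * cnj u"] by simp
  ultimately show False using u by (simp add: norm_mult)
qed

section \<open>The quadratic equation for the radius\<close>

lemma smaller_root_iff:
  fixes K M x :: real
  assumes "0 < M" "M < K"
  shows "x = K - sqrt ((K - M) * (K + M)) \<longleftrightarrow> x < M \<and> x\<^sup>2 - 2 * K * x + M\<^sup>2 = 0"
proof -
  define q where "q = sqrt ((K - M) * (K + M))"
  have q2: "q\<^sup>2 = (K - M) * (K + M)" using assms by (simp add: q_def)
  have q0: "q \<ge> 0" using assms by (simp add: q_def)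
  \<comment> \<open>The roots \<open>K - q\<close> and \<open>K + q\<close> have product
    \<open>M\<^sup>2\<close>, hence lie on different sides of \<open>M\<close>.\<close>
  have "(K - M)\<^sup>2 < q\<^sup>2" unfolding q2 using assms by (simp add: power2_eq_square)
  then have qK: "K - M < q" using q0 power2_less_imp_less by blast
  have "x = K - q" if "x < M" "x\<^sup>2 - 2 * K * x + M\<^sup>2 = 0"
  proof -
    have "(K - x)\<^sup>2 = q\<^sup>2" unfolding q2 using that(2) by algebra
    moreover have "0 \<le> K - x" using that(1) assms by simp
    ultimately have "K - x = q" using q0 by (rule power2_eq_imp_eq)
    then show ?thesis by simp
  qed
  moreover have "x < M \<and> x\<^sup>2 - 2 * K * x + M\<^sup>2 = 0" if "x = K - q"
  proof
    show "x < M" using qK that by simp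
    show "x\<^sup>2 - 2 * K * x + M\<^sup>2 = 0" unfolding that using q2 by algebra
  qed
  ultimately show ?thesis unfolding q_def by blast
qed

text \<open>Here \<open>D * (A + B)\<close> stands for \<open>S\<close>, so the closure condition
  becomes a quadratic in \<open>D\<close> alone, which encodes the radius. Nestedness will require
  \<open>D < M\<close> and so select the smaller root.\<close>

lemma radius_equation_iff:
  assumes "K = A + B - (Re m)\<^sup>2 + (Im m)\<^sup>2" and "M = 1 - (cmod m)\<^sup>2"
  shows "(cmod (m\<^sup>2 + of_real D))\<^sup>2 = 2 * (cmod m)\<^sup>2 - 1 + 2 * (D * (A + B))
    \<longleftrightarrow> D\<^sup>2 - 2 * K * D + M\<^sup>2 = 0"
proof -
  have "(cmod (m\<^sup>2 + of_real D))\<^sup>2 - (2 * (cmod m)\<^sup>2 - 1 + 2 * (D * (A + B))) = D\<^sup>2 - 2 * K * D + M\<^sup>2"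
    unfolding assms cmod_power2 by (simp add: algebra_simps power2_eq_square)
  then show ?thesis by (metis eq_iff_diff_eq_0)
qed

text \<open>\<open>D * A\<close> will be \<open>r\<^sup>2 / b\<^sup>2\<close>, so the last claim
  supplies the focal premise of \<open>circle_nested\<close>.\<close>

lemma foci_in_disc:
  assumes D: "0 < D" "D < M" "D\<^sup>2 - 2 * K * D + M\<^sup>2 = 0"
    and K: "K = A + B - (Re m)\<^sup>2 + (Im m)\<^sup>2" and M: "M = 1 - (cmod m)\<^sup>2"
    and AB: "A = B + 1" "B > 0"
    and f: "f = m + \<i> * of_real (sqrt D)" and g: "g = m - \<i> * of_real (sqrt D)"
  shows "cmod f < 1" "cmod g < 1" "(cmod (1 - cnj f * g))\<^sup>2 = 4 * (D * A)"
proof -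
  define x y h where "x = Re m" and "y = Im m" and "h = sqrt D"
  have h: "h\<^sup>2 = D" "h > 0" using D by (simp_all add: h_def)
  have M': "M = 1 - x\<^sup>2 - y\<^sup>2" unfolding M cmod_power2 x_def y_def by simp
  have K': "K = 2 * B + 1 - x\<^sup>2 + y\<^sup>2" unfolding K AB x_def y_def by simp
  \<comment> \<open>The left side is \<open>(1 - (cmod f)\<^sup>2) * (1 - (cmod g)\<^sup>2)\<close>;
    the factors share a sign, and \<open>D < M\<close> makes it positive.\<close>
  have "(M - D)\<^sup>2 - (2 * y * h)\<^sup>2 = 4 * B * D"
    using D(3) h(1) unfolding M' K' by algebra
  also have "\<dots> > 0" using AB D by simp
  finally have "\<bar>2 * y * h\<bar>\<^sup>2 < (M - D)\<^sup>2" by simp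
  then have small: "\<bar>2 * y * h\<bar> < M - D" using D by (metis diff_gt_0_iff_gt less_imp_le power2_less_imp_less)
  have "(cmod f)\<^sup>2 = 1 - (M - D) + 2 * y * h" "(cmod g)\<^sup>2 = 1 - (M - D) - 2 * y * h"
    unfolding cmod_power2 f g M' h_def[symmetric] using h(1)
    by (simp_all add: x_def y_def algebra_simps power2_eq_square)
  then have "(cmod f)\<^sup>2 < 1\<^sup>2" "(cmod g)\<^sup>2 < 1\<^sup>2" using small by auto
  then show "cmod f < 1" "cmod g < 1" by (simp_all add: power_less_one_iff)
  have "(cmod (1 - cnj f * g))\<^sup>2 = (M + h\<^sup>2)\<^sup>2 + 4 * h\<^sup>2 * x\<^sup>2"
    unfolding cmod_power2 f g M' h_def[symmetric]
    by (simp add: x_def y_def algebra_simps power2_eq_square)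
  also have "\<dots> = 4 * (D * A)"
    using D(3) unfolding h M' K' AB by algebra
  finally show "(cmod (1 - cnj f * g))\<^sup>2 = 4 * (D * A)" .
qed

text \<open>For unimodular numbers the signed area is, up to a nonzero factor, the product of the
  differences.\<close>

lemma unit_circle_not_collinear:
  assumes ab: "a > 0" "b > 0" and unit: "cmod x = 1" "cmod y = 1" "cmod z = 1"
    and ne: "x \<noteq> y" "y \<noteq> z" "z \<noteq> x"
  shows "\<not> collinear {emb a b x, emb a b y, emb a b z}"
proof -
  define k where "k = Re (y - x) * Im (z - x) - Im (y - x) * Re (z - x)"
  have c: "x * cnj x = 1" "y * cnj y = 1" "z * cnj z = 1"
    using unit by (simp_all add: complex_norm_square[symmetric])
  have "2 * \<i> * of_real k = cnj (y - x) * (z - x) - (y - x) * cnj (z - x)"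
    by (simp add: k_def complex_eq_iff algebra_simps)
  then have "2 * \<i> * of_real k * (x * y * z) = (y - x) * (z - x) * (y - z)"
    unfolding complex_cnj_diff using c by algebra
  then have "k \<noteq> 0" using ne by auto
  moreover have "cross (emb a b y - emb a b x) (emb a b z - emb a b x) = a * b * k"
    by (simp add: k_def emb_def cross_def algebra_simps)
  ultimately show ?thesis unfolding collinear_iff_cross using ab by simp
qed

text \<open>Nestedness puts the touching points inside the ellipse, hence between the vertices, so
  the circle is the incircle.\<close>

lemma nagel_point_poncelet:
  assumes ab: "a > 0" "b > 0" and F: "(P\<^sub>1, P\<^sub>2, P\<^sub>3) \<in> poncelet_family a b J"
  shows "nagel_point P\<^sub>1 P\<^sub>2 P\<^sub>3 N \<longleftrightarrow> N = P\<^sub>1 + P\<^sub>2 + P\<^sub>3 - 2 *\<^sub>R J"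
proof -
  from F obtain r X Y Z where nc: "\<not> collinear {P\<^sub>1, P\<^sub>2, P\<^sub>3}"
    and el: "P\<^sub>1 \<in> ellipse (0, 0) a b" "P\<^sub>2 \<in> ellipse (0, 0) a b" "P\<^sub>3 \<in> ellipse (0, 0) a b"
    and nested: "sphere J r \<subseteq> ellipse_interior (0, 0) a b"
    and t: "tangent_at P\<^sub>1 P\<^sub>2 J r X" "tangent_at P\<^sub>2 P\<^sub>3 J r Y" "tangent_at P\<^sub>3 P\<^sub>1 J r Z"
    unfolding poncelet_family_def circumscribes_def by auto
  have "T \<in> open_segment A B"
    if "A \<in> ellipse (0, 0) a b" "B \<in> ellipse (0, 0) a b" "tangent_at A B J r T" for A B T
  proof (rule chord_point_in_open_segment[OF ab that(1,2)])
    have "T \<in> affine hull {A, B} \<inter> sphere J r" using that(3) unfolding tangent_at_def by blast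
    then show "T \<in> affine hull {A, B}" "T \<in> ellipse_interior (0, 0) a b" using nested by blast+
  qed
  then show ?thesis using nagel_point_incentre[OF nc] t el by blast
qed

text \<open>Adding the inequalities for the top and bottom points of the circle cancels the term
  linear in \<open>m\<close>.\<close>

lemma centre_bound_of_nested:
  assumes ab: "a > 0" "b > 0" and r: "r > 0"
    and nested: "sphere (emb a b m) r \<subseteq> ellipse_interior (0, 0) a b"
  shows "r\<^sup>2 / b\<^sup>2 < 1 - (cmod m)\<^sup>2"
proof -
  have "(cmod (m + s *\<^sub>R Complex 0 (r / b)))\<^sup>2 < 1" if "s\<^sup>2 = 1" for s
  proof -
    have "(dist (emb a b m) (emb a b (m + s *\<^sub>R Complex 0 (r / b))))\<^sup>2 = r\<^sup>2"
      unfolding dist_emb_sq using ab that by (simp add: power_mult_distrib)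
    then have "emb a b (m + s *\<^sub>R Complex 0 (r / b)) \<in> sphere (emb a b m) r" using r by simp
    then have "cmod (m + s *\<^sub>R Complex 0 (r / b)) < 1" using nested emb_interior_iff[OF ab] by blast
    then show ?thesis by (simp add: power_less_one_iff)
  qed
  from this[of 1] this[of "-1"] show ?thesis
    unfolding cmod_power2 by (simp add: power2_eq_square algebra_simps)
qed

section \<open>The locus\<close>

text \<open>\<open>D\<close> is the value of
  \<open>r\<^sup>2 / b\<^sup>2 - r\<^sup>2 / a\<^sup>2\<close> forced by closure and nestedness, so
  all triangles of the family share one radius.\<close>

lemma locus_nagel_subset:
  assumes ab: "a > b" "b > 0" and m: "cmod m < 1"
    and AB: "A = a\<^sup>2 / (a\<^sup>2 - b\<^sup>2)" "B = b\<^sup>2 / (a\<^sup>2 - b\<^sup>2)"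
    and K: "K = A + B - (Re m)\<^sup>2 + (Im m)\<^sup>2" and M: "M = 1 - (cmod m)\<^sup>2" "M < K"
    and D: "D = K - sqrt ((K - M) * (K + M))"
  shows "locus (poncelet_family a b (emb a b m)) nagel_point \<subseteq> emb a b ` sphere 0 (cmod (m\<^sup>2 + of_real D))"
proof
  fix N assume "N \<in> locus (poncelet_family a b (emb a b m)) nagel_point"
  then obtain P\<^sub>1 P\<^sub>2 P\<^sub>3 where F: "(P\<^sub>1, P\<^sub>2, P\<^sub>3) \<in> poncelet_family a b (emb a b m)"
    and N: "nagel_point P\<^sub>1 P\<^sub>2 P\<^sub>3 N"
    unfolding locus_def by blast
  have a: "a > 0" using ab by simp
  obtain r where nc: "\<not> collinear {P\<^sub>1, P\<^sub>2, P\<^sub>3}"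
    and el: "P\<^sub>1 \<in> ellipse (0, 0) a b" "P\<^sub>2 \<in> ellipse (0, 0) a b" "P\<^sub>3 \<in> ellipse (0, 0) a b"
    and r: "r > 0" and nested: "sphere (emb a b m) r \<subseteq> ellipse_interior (0, 0) a b"
    and t: "circumscribes P\<^sub>1 P\<^sub>2 P\<^sub>3 (emb a b m) r"
    using F unfolding poncelet_family_def by auto
  obtain z\<^sub>1 z\<^sub>2 z\<^sub>3 where P: "P\<^sub>1 = emb a b z\<^sub>1" "P\<^sub>2 = emb a b z\<^sub>2" "P\<^sub>3 = emb a b z\<^sub>3"
    using emb_inverse[OF a ab(2)] by metis
  have unit: "cmod z\<^sub>1 = 1" "cmod z\<^sub>2 = 1" "cmod z\<^sub>3 = 1"
    using el emb_mem_ellipse_iff[OF a ab(2)] unfolding P by blast+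
  have ne: "z\<^sub>1 \<noteq> z\<^sub>2" "z\<^sub>2 \<noteq> z\<^sub>3" "z\<^sub>3 \<noteq> z\<^sub>1"
    using nc unfolding P by (auto simp: insert_commute)
  define d s where "d = r\<^sup>2 / b\<^sup>2 - r\<^sup>2 / a\<^sup>2" and "s = r\<^sup>2 / a\<^sup>2 + r\<^sup>2 / b\<^sup>2"
  have zero: "chord_form m d s z\<^sub>1 z\<^sub>2 = 0" "chord_form m d s z\<^sub>2 z\<^sub>3 = 0" "chord_form m d s z\<^sub>3 z\<^sub>1 = 0"
    using t tangent_chord_iff[OF a ab(2) r _ _ _ d_def s_def] unit ne
    unfolding circumscribes_def P by blast+
  have nz: "z\<^sub>1 \<noteq> 0" using unit by auto
  have c2: "a\<^sup>2 - b\<^sup>2 > 0" using ab by (simp add: power_strict_mono)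
  have "s = d * (A + B)"
    unfolding s_def d_def AB using a ab c2 by (simp add: divide_simps) algebra
  then have "d\<^sup>2 - 2 * K * d + M\<^sup>2 = 0"
    using chord_form_triangle(2)[OF nz ne zero] radius_equation_iff[OF K M(1), of d] by simp
  \<comment> \<open>\<open>d\<close> is below \<open>r\<^sup>2 / b\<^sup>2\<close>, which nestedness
    keeps below \<open>M\<close>; this excludes the larger root.\<close>
  moreover have "d < M"
    using centre_bound_of_nested[OF a ab(2) r nested] r a
    unfolding M d_def by (smt (verit) divide_pos_pos zero_less_power)
  moreover have "M > 0" using m unfolding M by (simp add: power_less_one_iff)
  ultimately have dD: "d = D" unfolding D using smaller_root_iff M(2) by blast
  define w where "w = z\<^sub>1 * z\<^sub>2 * z\<^sub>3 * cnj (m\<^sup>2 + of_real D)"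
  have "N = emb a b (z\<^sub>1 + z\<^sub>2 + z\<^sub>3 - 2 *\<^sub>R m)"
    using N nagel_point_poncelet[OF a ab(2) F] unfolding P by (simp add: emb_simps)
  also have "z\<^sub>1 + z\<^sub>2 + z\<^sub>3 - 2 *\<^sub>R m = w"
    using chord_form_triangle(1)[OF nz ne zero] unfolding dD w_def
    by (simp add: scaleR_conv_of_real)
  finally have "N = emb a b w" .
  moreover have "cmod w = cmod (m\<^sup>2 + of_real D)"
    unfolding w_def norm_mult complex_mod_cnj unit by simp
  ultimately show "N \<in> emb a b ` sphere 0 (cmod (m\<^sup>2 + of_real D))" by simp
qed

lemma locus_nagel_supset:
  assumes ab: "a > b" "b > 0" and m: "cmod m < 1"
    and AB: "A = a\<^sup>2 / (a\<^sup>2 - b\<^sup>2)" "B = b\<^sup>2 / (a\<^sup>2 - b\<^sup>2)"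
    and K: "K = A + B - (Re m)\<^sup>2 + (Im m)\<^sup>2" and M: "M = 1 - (cmod m)\<^sup>2" "M < K"
    and D: "D = K - sqrt ((K - M) * (K + M))"
  shows "emb a b ` sphere 0 (cmod (m\<^sup>2 + of_real D)) \<subseteq> locus (poncelet_family a b (emb a b m)) nagel_point"
proof
  fix N assume "N \<in> emb a b ` sphere 0 (cmod (m\<^sup>2 + of_real D))"
  then obtain w where w: "N = emb a b w" "cmod w = cmod (m\<^sup>2 + of_real D)" by (metis imageE mem_sphere_0)
  have a: "a > 0" using ab by simp
  have c2: "a\<^sup>2 - b\<^sup>2 > 0" using ab by (simp add: power_strict_mono)
  have A1: "A = B + 1" "B > 0" unfolding AB using c2 ab by (simp_all add: field_simps)
  have M0: "M > 0" using m unfolding M by (simp add: power_less_one_iff)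
  have root: "D < M" "D\<^sup>2 - 2 * K * D + M\<^sup>2 = 0" using D smaller_root_iff[OF M0 M(2)] by blast+
  have "0 < M\<^sup>2 + D\<^sup>2" using M0 by (simp add: add_pos_nonneg)
  then have "0 < 2 * K * D" using root(2) by linarith
  then have D0: "D > 0" using M0 M(2) by (simp add: zero_less_mult_iff)
  define f g where "f = m + \<i> * of_real (sqrt D)" and "g = m - \<i> * of_real (sqrt D)"
  note foci = foci_in_disc[OF D0 root K M(1) A1 f_def g_def]
  \<comment> \<open>Solves \<open>D = r\<^sup>2 / b\<^sup>2 - r\<^sup>2 / a\<^sup>2\<close> for the
    radius.\<close>
  define r where "r = a * b * sqrt (D / (a\<^sup>2 - b\<^sup>2))"
  have r: "r > 0" unfolding r_def using a ab D0 c2 by simp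
  have "r\<^sup>2 = (a * b)\<^sup>2 * (D / (a\<^sup>2 - b\<^sup>2))"
    unfolding r_def using D0 c2 by (simp add: power_mult_distrib)
  then have rab: "r\<^sup>2 / b\<^sup>2 = D * A" "r\<^sup>2 / a\<^sup>2 = D * B"
    unfolding AB using a ab by (simp_all add: power_mult_distrib)
  have Dr: "D = r\<^sup>2 / b\<^sup>2 - r\<^sup>2 / a\<^sup>2" unfolding rab A1 by (simp add: algebra_simps)
  define S where "S = r\<^sup>2 / a\<^sup>2 + r\<^sup>2 / b\<^sup>2"
  have nested: "sphere (emb a b m) r \<subseteq> ellipse_interior (0, 0) a b"
    using circle_nested[OF ab r Dr f_def foci(1) g_def foci(2)] foci(3) rab by simp
  have "S = D * (A + B)" unfolding S_def rab by (simp add: algebra_simps)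
  then have QQ: "(cmod (m\<^sup>2 + of_real D))\<^sup>2 = 2 * (cmod m)\<^sup>2 - 1 + 2 * S"
    using radius_equation_iff[OF K M(1), of D] root(2) by simp
  \<comment> \<open>If \<open>w = 0\<close>, its cofactor vanishes as well, and any unimodular
    \<open>l\<close> would serve.\<close>
  define l where "l = (if w = 0 then 1 else w / cnj (m\<^sup>2 + of_real D))"
  have l: "cmod l = 1" "l * cnj (m\<^sup>2 + of_real D) = w"
  proof -
    have "cmod (cnj (m\<^sup>2 + of_real D)) = cmod w" unfolding complex_mod_cnj w(2) ..
    moreover from this have "cnj (m\<^sup>2 + of_real D) = 0 \<longleftrightarrow> w = 0" by (metis norm_eq_zero)
    ultimately show "cmod l = 1" "l * cnj (m\<^sup>2 + of_real D) = w"
      unfolding l_def by (auto simp: norm_divide simp del: complex_cnj_add complex_cnj_power)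
  qed
  obtain x y z where sum: "x + y + z = 2 * m + l * cnj (m\<^sup>2 + of_real D)"
    and sum2: "x * y + x * z + y * z = m\<^sup>2 + of_real D + 2 * l * cnj m" and l_eq: "x * y * z = l"
    using cubic_splits by blast
  \<comment> \<open>Invariant under cyclic shifts: what is proved for one vertex or edge transfers
    to all three.\<close>
  define V where "V = (\<lambda>x y z. x + y + z = 2 * m + x * y * z * cnj (m\<^sup>2 + of_real D) \<and>
      x * y + x * z + y * z = m\<^sup>2 + of_real D + 2 * (x * y * z) * cnj m \<and> x * y * z = l)"
  have V: "V x y z" "V y z x" "V z x y"
    using sum sum2 l_eq unfolding V_def by (simp_all add: algebra_simps)
  have unim: "cmod x = 1" if "V x y z" for x y z
  proof (rule blaschke_unimodular[OF foci(1,2) l(1)])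
    \<comment> \<open>As \<open>q\<^sup>2 = - D\<close>, the product
      \<open>(x - f) * (x - g)\<close> is \<open>(x - m)\<^sup>2 + D\<close>, which turns Vieta's
      formulas into the Blaschke equation.\<close>
    define q where "q = \<i> * complex_of_real (sqrt D)"
    have q: "q\<^sup>2 = - of_real D" "cnj q = - q"
      using D0 by (simp_all add: q_def power_mult_distrib flip: of_real_power)
    have "x + y + z = 2 * m + l * ((cnj m)\<^sup>2 + of_real D)"
      "x * y + x * z + y * z = m\<^sup>2 + of_real D + 2 * l * cnj m" "x * y * z = l"
      using that by (simp_all add: V_def)
    then show "x * (x - f) * (x - g) = l * ((1 - cnj f * x) * (1 - cnj g * x))"
      unfolding f_def g_def q_def[symmetric] complex_cnj_add complex_cnj_diff q(2) using q(1) by algebra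
  qed
  have unit: "cmod x = 1" "cmod y = 1" "cmod z = 1" using unim V by blast+
  have edge: "chord_form m D S x y = 0 \<and> x \<noteq> y" if "V x y z" for x y z
  proof
    have "cmod x = 1" using unim that by blast
    then have "x \<noteq> 0" by auto
    then show zero: "chord_form m D S x y = 0"
      using chord_form_of_roots QQ that unfolding V_def by blast
    show "x \<noteq> y"
      using chord_form_diagonal_nonzero[OF a ab(2) r \<open>cmod x = 1\<close> m Dr S_def nested] zero by blast
  qed
  note ne = edge[OF V(1), THEN conjunct2] edge[OF V(2), THEN conjunct2] edge[OF V(3), THEN conjunct2]
  have "circumscribes (emb a b x) (emb a b y) (emb a b z) (emb a b m) r"
    unfolding circumscribes_def
    using tangent_chord_iff[OF a ab(2) r _ _ _ Dr S_def] unit ne edge V by blast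
  then have F: "(emb a b x, emb a b y, emb a b z) \<in> poncelet_family a b (emb a b m)"
    unfolding poncelet_family_def
    using unit_circle_not_collinear[OF a ab(2) unit ne] emb_mem_ellipse_iff[OF a ab(2)] unit r nested
    by auto
  have "x + y + z - 2 *\<^sub>R m = w" using sum l(2) by (simp add: scaleR_conv_of_real)
  then have "N = emb a b x + emb a b y + emb a b z - 2 *\<^sub>R emb a b m"
    unfolding w(1) by (simp flip: emb_simps)
  then have "nagel_point (emb a b x) (emb a b y) (emb a b z) N"
    using nagel_point_poncelet[OF a ab(2) F] by blast
  then show "N \<in> locus (poncelet_family a b (emb a b m)) nagel_point"
    unfolding locus_def using F by blast
qed

theorem proposition8:
  fixes a b c x\<^sub>c y\<^sub>c \<delta> \<delta>\<^sub>8 a\<^sub>8 b\<^sub>8 :: real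
  assumes "a > b" and "b > 0" and "c\<^sup>2 = a\<^sup>2 - b\<^sup>2"
    and "(x\<^sub>c, y\<^sub>c) \<in> ellipse_interior (0, 0) a b"
    and "\<delta> = sqrt ((b^4 + c\<^sup>2 * y\<^sub>c\<^sup>2) * (a^4 - c\<^sup>2 * x\<^sub>c\<^sup>2))"
    and "\<delta>\<^sub>8 = (a^3 * b + a * b^3 - 2 * \<delta>)\<^sup>2 + 4 * c^4 * x\<^sub>c\<^sup>2 * y\<^sub>c\<^sup>2"
    and "a\<^sub>8 = sqrt \<delta>\<^sub>8 / (b * c\<^sup>2)" and "b\<^sub>8 = sqrt \<delta>\<^sub>8 / (a * c\<^sup>2)"
  shows "locus (poncelet_family a b (x\<^sub>c, y\<^sub>c)) nagel_point = ellipse (0, 0) a\<^sub>8 b\<^sub>8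
    \<and> (\<exists>k\<ge>0. locus (poncelet_family a b (x\<^sub>c, y\<^sub>c)) nagel_point
               = (\<lambda>P. k *\<^sub>R P) ` ellipse (0, 0) a b)"
proof -
  note ab = assms(1,2)
  have a: "a > 0" using ab by simp
  have c2: "c\<^sup>2 > 0" unfolding assms(3) using ab by (simp add: power_strict_mono)
  then have c0: "c \<noteq> 0" by auto
  define m where "m = Complex (x\<^sub>c / a) (y\<^sub>c / b)"
  have C: "(x\<^sub>c, y\<^sub>c) = emb a b m" using a ab by (simp add: m_def emb_def)
  have m: "cmod m < 1" using assms(4) emb_interior_iff[OF a ab(2)] unfolding C by blast
  define A B where "A = a\<^sup>2 / (a\<^sup>2 - b\<^sup>2)" and "B = b\<^sup>2 / (a\<^sup>2 - b\<^sup>2)"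
  define K M where "K = A + B - (Re m)\<^sup>2 + (Im m)\<^sup>2" and "M = 1 - (cmod m)\<^sup>2"
  define D where "D = K - sqrt ((K - M) * (K + M))"
  \<comment> \<open>The homothety ratio, the modulus of the product of the foci; if it is zero, the
    locus is a point.\<close>
  define k where "k = cmod (m\<^sup>2 + of_real D)"
  define e where "e = a * b * c\<^sup>2"
  have e: "e > 0" unfolding e_def using a ab c2 by simp
  have A1: "A - B = 1" unfolding A_def B_def using c2 assms(3) by (simp flip: diff_divide_distrib)
  have M': "M = 1 - (Re m)\<^sup>2 - (Im m)\<^sup>2" unfolding M_def cmod_power2 by simp
  \<comment> \<open>The factors of the discriminant are, up to constants, the two factors under the
    root in \<open>\<delta>\<close>.\<close>
  have "K - M = 2 * B + 2 * (Im m)\<^sup>2" unfolding K_def M' using A1 by simp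
  also have "\<dots> = 2 * (b^4 + c\<^sup>2 * y\<^sub>c\<^sup>2) / (b\<^sup>2 * c\<^sup>2)"
    unfolding B_def assms(3)[symmetric] m_def using ab c0 by (simp add: field_simps power2_eq_square power4_eq_xxxx)
  finally have KM: "K - M = 2 * (b^4 + c\<^sup>2 * y\<^sub>c\<^sup>2) / (b\<^sup>2 * c\<^sup>2)" .
  have "K + M = 2 * A - 2 * (Re m)\<^sup>2" unfolding K_def M' using A1 by simp
  also have "\<dots> = 2 * (a^4 - c\<^sup>2 * x\<^sub>c\<^sup>2) / (a\<^sup>2 * c\<^sup>2)"
    unfolding A_def assms(3)[symmetric] m_def using a c0 by (simp add: field_simps power2_eq_square power4_eq_xxxx)
  finally have KM': "K + M = 2 * (a^4 - c\<^sup>2 * x\<^sub>c\<^sup>2) / (a\<^sup>2 * c\<^sup>2)" .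
  have "b^4 + c\<^sup>2 * y\<^sub>c\<^sup>2 > 0" using ab by (simp add: add_pos_nonneg)
  then have "K - M > 0" unfolding KM using ab c2 by simp
  then have MK: "M < K" by simp
  have "(K - M) * (K + M) = 4 * ((b^4 + c\<^sup>2 * y\<^sub>c\<^sup>2) * (a^4 - c\<^sup>2 * x\<^sub>c\<^sup>2)) / e\<^sup>2"
    unfolding KM KM' e_def times_divide_times_eq by (simp add: power2_eq_square algebra_simps)
  then have "sqrt ((K - M) * (K + M)) = 2 * \<delta> / e"
    using e unfolding assms(5) by (simp add: real_sqrt_divide real_sqrt_mult)
  then have D: "D = K - 2 * \<delta> / e" by (simp add: D_def)
  \<comment> \<open>The squares of \<open>Re m\<close> and \<open>Im m\<close> in \<open>K\<close>
    cancel those in \<open>m\<^sup>2\<close>. The real and imaginary parts then yield the two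
    squares in \<open>\<delta>\<^sub>8\<close>.\<close>
  have "Re (m\<^sup>2 + of_real D) = A + B - 2 * \<delta> / e"
    unfolding D K_def by (simp add: power2_eq_square)
  also have "A + B = (a^3 * b + a * b^3) / e"
    unfolding A_def B_def assms(3)[symmetric] e_def using a ab c0
    by (simp add: field_simps power2_eq_square power3_eq_cube)
  finally have re: "Re (m\<^sup>2 + of_real D) = (a^3 * b + a * b^3 - 2 * \<delta>) / e"
    by (simp add: diff_divide_distrib)
  have im: "Im (m\<^sup>2 + of_real D) = 2 * c\<^sup>2 * x\<^sub>c * y\<^sub>c / e"
    unfolding m_def e_def using a ab c0 by (simp add: power2_eq_square)
  have "k\<^sup>2 = \<delta>\<^sub>8 / e\<^sup>2"
    unfolding k_def cmod_power2 re im assms(6)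
    by (simp add: power_divide power_mult_distrib add_divide_distrib flip: power_mult)
  then have "k = sqrt (\<delta>\<^sub>8 / e\<^sup>2)" by (simp add: k_def real_sqrt_unique)
  then have k: "k = sqrt \<delta>\<^sub>8 / e" using e by (simp add: real_sqrt_divide)
  have k0: "k \<ge> 0" by (simp add: k_def)
  have axes: "a\<^sub>8 = k * a" "b\<^sub>8 = k * b"
    unfolding k assms(7,8) e_def using a ab by simp_all
  have "locus (poncelet_family a b (x\<^sub>c, y\<^sub>c)) nagel_point = emb a b ` sphere 0 k"
    unfolding C k_def
    using locus_nagel_subset[OF ab m A_def B_def K_def M_def MK D_def]
      locus_nagel_supset[OF ab m A_def B_def K_def M_def MK D_def] by blast
  then have "locus (poncelet_family a b (x\<^sub>c, y\<^sub>c)) nagel_point = ellipse (0, 0) a\<^sub>8 b\<^sub>8"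
    unfolding axes using ellipse_eq_emb_sphere[OF a ab(2) k0] by simp
  then show ?thesis using scale_ellipse[OF a ab(2) k0] axes k0 by metis
qed

end
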